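(* Let $\mathcal{C}=(C_1,\dots,C_m)$ be any camera arrangement. Set-theoretically, the line multiview variety $\mathcal{L}_{\mathcal{C}}$ is cut out by the ideal $\widetilde{I}_{\mathcal{C}}$; that is, $\mathcal{L}_{\mathcal{C}}$ is the set of points of $(\mathbb{P}^2)^m$ at which all polynomials of $\widetilde{I}_{\mathcal{C}}$ vanish.
   Context: A camera is a matrix $C\in\mathbb{C}^{3\times4}$ of rank $3$ with center $\ker C\in\mathbb{P}^3$. A camera arrangement is a tuple $\mathcal{C}=(C_1,\dots,C_m)$ of $m\ge2$ cameras with pairwise distinct centers $c_1,\dots,c_m$ (standing assumption). Cameras are collinear if their centers lie on a common line. The line multiview variety $\mathcal{L}_{\mathcal{C}}\subseteq(\mathbb{P}^2)^m$ is the Zariski closure of the set of tuples $(\ell_1,\dots,\ell_m)$, $\ell_i=(C_ia)\times(C_ib)$, where $a,b$ span a line in $\mathbb{P}^3$ containing no center. Let $R=\mathbb{C}[\ell_{i,j}\mid1\le i\le3,1\le j\le m]$, $\ell_k=(\ell_{1,k},\ell_{2,k},\ell_{3,k})^T$ and $M(\ell)=\begin{bmatrix}C_1^T\ell_1&\cdots&C_m^T\ell_m\end{bmatrix}\in R^{4\times m}$. For a $4$-element set $\sigma=\{i_1<i_2<i_3<i_4\}\subseteq[m]$ of indices of collinear cameras let $E_\sigma$ be the line spanned by their centers, let $E_\sigma^*$ be any chosen line disjoint from $E_\sigma$, and $f=(f_1,f_2,f_3)$ (depending on $\sigma$) three distinct points of $E_\sigma^*$. Fix representatives in $\mathbb{C}^4$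 of $c_i,f_1,f_2,f_3$. For $i\in\sigma$ let $h_i=C_i^T\ell_i$ and $e_i(\ell_i)=c_i-(h_i^Tf_2)f_1+(h_i^Tf_1)f_2$. Let $\nu:\mathbb{C}^4\to\mathbb{C}^{10}$, $\nu(x,y,z,w)=(x^2,y^2,z^2,w^2,xy,xz,xw,yz,yw,zw)^T$. $\Phi_{\mathcal{C},f,\sigma}(\ell)$ is the $10\times10$ matrix obtained by applying $\nu$ to each column of $\begin{bmatrix}c_{i_1}&c_{i_2}&c_{i_3}&f_1&f_2&f_3&e_{i_1}(\ell_{i_1})&e_{i_2}(\ell_{i_2})&e_{i_3}(\ell_{i_3})&e_{i_4}(\ell_{i_4})\end{bmatrix}$. Finally $$\widetilde{I}_{\mathcal{C}}:=\langle3\times3\text{-minors of }M(\ell)\rangle+\sum_{\sigma\in\mathcal{J}}\langle\det\Phi_{\mathcal{C},f,\sigma}(\ell)\rangle\subseteq R,$$ where $\mathcal{J}$ is the collection of index sets of four collinear cameras. *)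

theory Defs
  imports "HOL-Analysis.Analysis" "HOL-Library.Poly_Mapping" "HOL-Library.Numeral_Type"
begin

section \<open>Polynomials in the variables \<open>l_{a,j}\<close>\<close>

text \<open>The index set \<open>[m]\<close> is a finite linearly ordered type \<open>'m\<close> with \<open>CARD('m) = m\<close>.
  A polynomial maps monomials to coefficients, and a monomial maps variables to exponents.
  The numeral type \<open>3\<close> has the elements \<open>1, 2, 3\<close> (with \<open>3 = 0\<close>); likewise \<open>4\<close> and \<open>10\<close>.\<close>

type_synonym 'm line_poly = "((3 \<times> 'm) \<Rightarrow>\<^sub>0 nat) \<Rightarrow>\<^sub>0 complex"

definition Const :: "complex \<Rightarrow> 'm line_poly" where
  "Const c = Poly_Mapping.single 0 c"

definition Var :: "3 \<times> 'm \<Rightarrow> 'm line_poly" where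
  "Var v = Poly_Mapping.single (Poly_Mapping.single v 1) 1"

definition const_vec :: "complex ^ 'n \<Rightarrow> 'm line_poly ^ 'n" where
  "const_vec v = (\<chi> a. Const (v $ a))"

definition line_var :: "'m \<Rightarrow> 'm line_poly ^ 3" where
  "line_var j = (\<chi> a. Var (a, j))"

definition poly_eval :: "('m::finite \<Rightarrow> complex ^ 3) \<Rightarrow> 'm line_poly \<Rightarrow> complex" where
  "poly_eval x p = (\<Sum>u\<in>Poly_Mapping.keys p.
     Poly_Mapping.lookup p u * (\<Prod>(a, j)\<in>UNIV. (x j $ a) ^ Poly_Mapping.lookup u (a, j)))"

definition multihomogeneous :: "'m line_poly \<Rightarrow> bool" where
  "multihomogeneous p \<longleftrightarrow> (\<exists>d :: 'm \<Rightarrow> nat. \<forall>u\<in>Poly_Mapping.keys p. \<forall>j.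
     (\<Sum>a\<in>UNIV. Poly_Mapping.lookup u (a, j)) = d j)"

definition ideal_of :: "'a::comm_ring_1 set \<Rightarrow> 'a set" where
  "ideal_of S = module.span (*) S"


section \<open>The product of projective planes and its Zariski topology\<close>

text \<open>A point of projective space is a one-dimensional linear subspace.\<close>

definition proj_point :: "complex ^ 'n \<Rightarrow> (complex ^ 'n) set" where
  "proj_point v = vec.span {v}"

definition proj_space :: "(complex ^ 'n) set set" where
  "proj_space = {proj_point v | v. v \<noteq> 0}"

definition multiproj :: "('m \<Rightarrow> (complex ^ 3) set) set" where
  "multiproj = {P. \<forall>j. P j \<in> proj_space}"

text \<open>Vanishing is required at all representatives, so that it is meaningful for polynomials
  that are not multihomogeneous; for multihomogeneous ones a single representative suffices.\<close>

definition vanishes_at :: "'m::finite line_poly \<Rightarrow> ('m \<Rightarrow> (complex ^ 3) set) \<Rightarrow> bool" where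
  "vanishes_at p P \<longleftrightarrow> (\<forall>x. (\<forall>j. proj_point (x j) = P j) \<longrightarrow> poly_eval x p = 0)"

definition zero_locus :: "'m::finite line_poly set \<Rightarrow> ('m \<Rightarrow> (complex ^ 3) set) set" where
  "zero_locus S = {P \<in> multiproj. \<forall>p\<in>S. vanishes_at p P}"

definition zariski_closed :: "('m::finite \<Rightarrow> (complex ^ 3) set) set \<Rightarrow> bool" where
  "zariski_closed Z \<longleftrightarrow> (\<exists>S. (\<forall>p\<in>S. multihomogeneous p) \<and> Z = zero_locus S)"

definition zariski_closure ::
    "('m::finite \<Rightarrow> (complex ^ 3) set) set \<Rightarrow> ('m \<Rightarrow> (complex ^ 3) set) set" where
  "zariski_closure A = \<Inter>{Z. zariski_closed Z \<and> A \<subseteq> Z}"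


section \<open>Cameras and the line multiview variety\<close>

text \<open>A \<open>3 \<times> 4\<close> matrix has type \<open>complex ^ 4 ^ 3\<close> (columns before rows).\<close>

definition center :: "complex ^ 4 ^ 3 \<Rightarrow> (complex ^ 4) set" where
  "center A = {x. A *v x = 0}"

definition camera_arrangement :: "('m::finite \<Rightarrow> complex ^ 4 ^ 3) \<Rightarrow> bool" where
  "camera_arrangement C \<longleftrightarrow>
     CARD('m) \<ge> 2 \<and> (\<forall>i. rank (C i) = 3) \<and> inj (\<lambda>i. center (C i))"

text \<open>A line in projective 3-space is a two-dimensional linear subspace; it contains a
  projective point if that point is a subset of it.\<close>

definition is_line :: "(complex ^ 4) set \<Rightarrow> bool" where
  "is_line E \<longleftrightarrow> vec.subspace E \<and> vec.dim E = 2"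

definition collinear_cameras :: "('m \<Rightarrow> complex ^ 4 ^ 3) \<Rightarrow> 'm set \<Rightarrow> bool" where
  "collinear_cameras C \<sigma> \<longleftrightarrow> (\<exists>E. is_line E \<and> (\<forall>i\<in>\<sigma>. center (C i) \<subseteq> E))"

definition cross_prod :: "complex ^ 3 \<Rightarrow> complex ^ 3 \<Rightarrow> complex ^ 3" where
  "cross_prod x y = vector [x$2 * y$3 - x$3 * y$2, x$3 * y$1 - x$1 * y$3, x$1 * y$2 - x$2 * y$1]"

definition line_multiview_variety ::
    "('m::finite \<Rightarrow> complex ^ 4 ^ 3) \<Rightarrow> ('m \<Rightarrow> (complex ^ 3) set) set" where
  "line_multiview_variety C = zariski_closure
     {\<lambda>i. proj_point (cross_prod (C i *v a) (C i *v b)) | a b.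
        is_line (vec.span {a, b}) \<and> (\<forall>i. \<not> center (C i) \<subseteq> vec.span {a, b})}"


section \<open>The ideal\<close>

definition back_plane :: "('m \<Rightarrow> complex ^ 4 ^ 3) \<Rightarrow> 'm \<Rightarrow> 'm line_poly ^ 4" where
  "back_plane C i = map_matrix Const (transpose (C i)) *v line_var i"

definition back_matrix :: "('m \<Rightarrow> complex ^ 4 ^ 3) \<Rightarrow> 'm line_poly ^ 'm ^ 4" where
  "back_matrix C = (\<chi> a j. back_plane C j $ a)"

definition minors3 :: "'a::comm_ring_1 ^ 'c::{finite,linorder} ^ 'r::{finite,linorder} \<Rightarrow> 'a set" where
  "minors3 A = {det (\<chi> a b. A $ r a $ k b :: 'a ^ 3 ^ 3) | (r :: 3 \<Rightarrow> 'r) (k :: 3 \<Rightarrow> 'c).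
     strict_mono r \<and> strict_mono k}"

definition four_collinear :: "('m::finite \<Rightarrow> complex ^ 4 ^ 3) \<Rightarrow> 'm set set" where
  "four_collinear C = {\<sigma>. card \<sigma> = 4 \<and> collinear_cameras C \<sigma>}"

definition centers_line :: "('m \<Rightarrow> complex ^ 4 ^ 3) \<Rightarrow> 'm set \<Rightarrow> (complex ^ 4) set" where
  "centers_line C \<sigma> = vec.span (\<Union>i\<in>\<sigma>. center (C i))"

text \<open>For each \<open>\<sigma>\<close>, the vectors \<open>f \<sigma> 1, f \<sigma> 2, f \<sigma> 3\<close> represent three distinct points of some
  line disjoint from the line of the centers. Disjointness of projective lines means that the
  linear subspaces meet only in \<open>0\<close>.\<close>

definition valid_choice ::
    "('m::finite \<Rightarrow> complex ^ 4 ^ 3) \<Rightarrow> ('m set \<Rightarrow> (complex ^ 4) set) \<Rightarrow>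
     ('m set \<Rightarrow> 3 \<Rightarrow> complex ^ 4) \<Rightarrow> bool" where
  "valid_choice C E' f \<longleftrightarrow> (\<forall>\<sigma>\<in>four_collinear C.
     is_line (E' \<sigma>) \<and> E' \<sigma> \<inter> centers_line C \<sigma> = {0} \<and>
     (\<forall>k. f \<sigma> k \<noteq> 0 \<and> f \<sigma> k \<in> E' \<sigma>) \<and> inj (\<lambda>k. proj_point (f \<sigma> k)))"

definition e_vec ::
    "('m \<Rightarrow> complex ^ 4 ^ 3) \<Rightarrow> ('m \<Rightarrow> complex ^ 4) \<Rightarrow> (3 \<Rightarrow> complex ^ 4) \<Rightarrow> 'm \<Rightarrow>
     'm line_poly ^ 4" where
  "e_vec C c g i = const_vec (c i)
     - scalar_product (back_plane C i) (const_vec (g 2)) *s const_vec (g 1)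
     + scalar_product (back_plane C i) (const_vec (g 1)) *s const_vec (g 2)"

definition nu :: "'a::comm_ring_1 ^ 4 \<Rightarrow> 'a ^ 10" where
  "nu v = (let x = v$1; y = v$2; z = v$3; w = v$4 in
     vector [x^2, y^2, z^2, w^2, x*y, x*z, x*w, y*z, y*w, z*w])"

text \<open>The list below consists of the columns of the matrix, hence the transposition.\<close>

definition Phi ::
    "('m::{finite,linorder} \<Rightarrow> complex ^ 4 ^ 3) \<Rightarrow> ('m \<Rightarrow> complex ^ 4) \<Rightarrow>
     (3 \<Rightarrow> complex ^ 4) \<Rightarrow> 'm set \<Rightarrow> 'm line_poly ^ 10 ^ 10" where
  "Phi C c g \<sigma> = (let i = (\<lambda>k. sorted_list_of_set \<sigma> ! k) in
     transpose (vector (map nu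
       [const_vec (c (i 0)), const_vec (c (i 1)), const_vec (c (i 2)),
        const_vec (g 1), const_vec (g 2), const_vec (g 3),
        e_vec C c g (i 0), e_vec C c g (i 1), e_vec C c g (i 2), e_vec C c g (i 3)])))"

definition tilde_ideal ::
    "('m::{finite,linorder} \<Rightarrow> complex ^ 4 ^ 3) \<Rightarrow> ('m \<Rightarrow> complex ^ 4) \<Rightarrow>
     ('m set \<Rightarrow> 3 \<Rightarrow> complex ^ 4) \<Rightarrow> 'm line_poly set" where
  "tilde_ideal C c f = ideal_of (minors3 (back_matrix C))
     + (\<Sum>\<sigma>\<in>four_collinear C. ideal_of {det (Phi C c (f \<sigma>) \<sigma>)})"

end

theory Submission
  imports Defs
begin

text \<open>A tuple of image lines amounts to a tuple of planes \<open>h\<^sub>i = C\<^sub>i\<^sup>T \<ell>\<^sub>i\<close> with \<open>h\<^sub>i\<close> passing through the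
  center \<open>c\<^sub>i\<close>.  The \<open>3 \<times> 3\<close>-minors vanish if and only if all these planes contain a common line \<open>L\<close>
  (\<open>minors_vanish_if_common_line\<close>, \<open>dim_le_2_if_minors_vanish\<close>, \<open>common_line_if_dim_le_2\<close>).  If \<open>L\<close>
  contains no center, then the tuple is the image of \<open>L\<close>.  Otherwise the planes \<open>h\<^sub>i\<close> of those
  cameras whose centers lie on \<open>L\<close> are not determined by \<open>L\<close>, and \<open>L\<close> has to be approximated by lines \<open>L\<^sub>t\<close> such
  that the plane joining \<open>c\<^sub>i\<close> and \<open>L\<^sub>t\<close> tends to \<open>h\<^sub>i\<close>.

  Let \<open>L\<^sub>t\<close> be the graph of \<open>t\<phi>\<close> for a linear map \<open>\<phi>\<close> from \<open>L\<close> to a complement of \<open>L\<close>.  The plane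
  joining \<open>c\<^sub>i\<close> and \<open>L\<^sub>t\<close> contains \<open>\<phi>(c\<^sub>i)\<close>, so the condition is \<open>\<phi>(c\<^sub>i) \<in> h\<^sub>i\<close>.  This is one linear
  equation for each center on \<open>L\<close>, and the unknown \<open>\<phi>\<close> lives in a space of dimension four.  Hence a
  nonzero solution exists as soon as any four of the equations have one
  (\<open>common_solution_if_four_by_four\<close>), and for four collinear centers this is what the vanishing of
  the determinant says (\<open>det_Phi_vanishes_iff\<close>): a quadric through the ten points contains the line
  of the centers and the line \<open>E\<^sup>*\<close>, such quadrics correspond to the maps \<open>\<phi>\<close> between the two lines,
  and passing through the points \<open>e\<^sub>i\<close> becomes \<open>\<phi>(c\<^sub>i) \<in> h\<^sub>i\<close>.

  A nonzero solution may still kill a center, but at most one, and for this one a term of second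
  order in \<open>t\<close> produces the required plane (\<open>second_order_term\<close>, \<open>image_of_moving_line\<close>).  Limits in the
  Euclidean topology lie in the Zariski closure (\<open>limit_in_line_multiview_variety\<close>), which shows that
  the zero locus is contained in the variety.

  For the reverse inclusion the zero locus is Zariski closed (\<open>zariski_closed_zero_locus\<close>), so only
  the planes \<open>h\<^sub>i\<close> that join the centers to a line \<open>L\<close> avoiding all centers matter.  For four collinear
  centers \<open>L\<close> itself yields a map \<open>\<phi>\<close> as above (\<open>dual_map_of_transversal\<close>), whence the
  determinants vanish.\<close>

section \<open>Evaluation of polynomials\<close>

definition monom_eval :: "('m::finite \<Rightarrow> complex ^ 3) \<Rightarrow> ((3 \<times> 'm) \<Rightarrow>\<^sub>0 nat) \<Rightarrow> complex" where
  "monom_eval x u = (\<Prod>(a, j)\<in>UNIV. (x j $ a) ^ Poly_Mapping.lookup u (a, j))"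

text \<open>Polynomials are finitely supported functions, so the sum of two of them may lose monomials.
  Enlarging the set of monomials that is summed over makes evaluation visibly additive.\<close>

lemma poly_eval_superset:
  assumes "finite S" "Poly_Mapping.keys p \<subseteq> S"
  shows "poly_eval x p = (\<Sum>u\<in>S. Poly_Mapping.lookup p u * monom_eval x u)"
  unfolding poly_eval_def monom_eval_def
  by (intro sum.mono_neutral_left) (use assms in \<open>auto simp: in_keys_iff\<close>)

lemma poly_eval_add: "poly_eval x (p + q) = poly_eval x p + poly_eval x q"
proof -
  let ?S = "Poly_Mapping.keys p \<union> Poly_Mapping.keys q"
  have "Poly_Mapping.keys (p + q) \<subseteq> ?S" by (rule Poly_Mapping.keys_add)
  then show ?thesis
    by (simp add: poly_eval_superset[of ?S] lookup_add ring_distribs sum.distrib)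
qed

lemma poly_eval_0 [simp]: "poly_eval x 0 = 0"
  by (simp add: poly_eval_def)

lemma poly_eval_sum: "poly_eval x (sum g A) = (\<Sum>i\<in>A. poly_eval x (g i))"
  by (induction A rule: infinite_finite_induct) (auto simp: poly_eval_add)

lemma poly_eval_single: "poly_eval x (Poly_Mapping.single u b) = b * monom_eval x u"
  by (subst poly_eval_superset[of "{u}"]) auto

lemma monom_eval_add: "monom_eval x (u + v) = monom_eval x u * monom_eval x v"
  by (simp add: monom_eval_def lookup_add power_add prod.distrib case_prod_unfold)

lemma monom_eval_0 [simp]: "monom_eval x 0 = 1"
  by (simp add: monom_eval_def)

lemma sum_singles: "(\<Sum>u\<in>Poly_Mapping.keys p. Poly_Mapping.single u (Poly_Mapping.lookup p u)) = p"
  by (rule poly_mapping_eqI) (auto simp: lookup_sum lookup_single when_def in_keys_iff)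

lemma poly_eval_mult: "poly_eval x (p * q) = poly_eval x p * poly_eval x q"
proof -
  let ?s = "\<lambda>p u. Poly_Mapping.single u (Poly_Mapping.lookup p u)"
  have e: "poly_eval x r = (\<Sum>u\<in>Poly_Mapping.keys r. poly_eval x (?s r u))" for r
    unfolding poly_eval_single by (simp add: poly_eval_def monom_eval_def)
  have "p * q = (\<Sum>u\<in>Poly_Mapping.keys p. \<Sum>v\<in>Poly_Mapping.keys q. ?s p u * ?s q v)"
    by (subst (1 2) sum_singles[symmetric]) (simp add: sum_product)
  then have "poly_eval x (p * q) =
      (\<Sum>u\<in>Poly_Mapping.keys p. \<Sum>v\<in>Poly_Mapping.keys q. poly_eval x (?s p u) * poly_eval x (?s q v))"
    by (simp add: poly_eval_sum mult_single poly_eval_single monom_eval_add algebra_simps)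
  then show ?thesis
    by (simp add: e[of p] e[of q] sum_product)
qed

lemma poly_eval_Const [simp]: "poly_eval x (Const b) = b"
  by (simp add: Const_def poly_eval_single)

lemma poly_eval_1 [simp]: "poly_eval x 1 = 1"
  using poly_eval_Const[of x 1] by (simp add: Const_def)

lemma poly_eval_Var [simp]: "poly_eval x (Var (a, j)) = x j $ a"
proof -
  have "monom_eval x (Poly_Mapping.single (a, j) 1) =
      (\<Prod>v\<in>UNIV. if v = (a, j) then x j $ a else 1)"
    unfolding monom_eval_def by (intro prod.cong refl) (auto simp: lookup_single when_def split: if_splits)
  then show ?thesis
    by (simp add: Var_def poly_eval_single)
qed

lemma poly_eval_uminus: "poly_eval x (- p) = - poly_eval x p"
  by (metis poly_eval_add poly_eval_0 add.right_inverse add_eq_0_iff)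

lemma poly_eval_diff: "poly_eval x (p - q) = poly_eval x p - poly_eval x q"
  by (metis poly_eval_add poly_eval_uminus add_uminus_conv_diff)

lemma poly_eval_prod: "poly_eval x (prod g A) = (\<Prod>i\<in>A. poly_eval x (g i))"
  by (induction A rule: infinite_finite_induct) (auto simp: poly_eval_mult)

lemma poly_eval_power: "poly_eval x (p ^ n) = poly_eval x p ^ n"
  by (induction n) (auto simp: poly_eval_mult)

lemma poly_eval_of_int: "poly_eval x (of_int k) = of_int k"
proof -
  have "poly_eval x (of_nat n) = of_nat n" for n
    by (induction n) (auto simp: poly_eval_add)
  then show ?thesis
    by (cases k) (simp_all add: poly_eval_uminus poly_eval_diff)
qed

lemma poly_eval_det: "poly_eval x (det A) = det (map_matrix (poly_eval x) A)"
  by (simp add: det_def poly_eval_sum poly_eval_mult poly_eval_prod poly_eval_of_int map_matrix_def)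

lemma tendsto_poly_eval:
  assumes "\<And>j. ((\<lambda>t. y t j) \<longlongrightarrow> x j) F"
  shows "((\<lambda>t. poly_eval (y t) p) \<longlongrightarrow> poly_eval x p) F"
  unfolding poly_eval_def case_prod_unfold
  by (intro tendsto_intros assms)

lemma poly_eval_ideal_of_eq_0:
  assumes "p \<in> ideal_of S" "\<And>q. q \<in> S \<Longrightarrow> poly_eval x q = 0"
  shows "poly_eval x p = 0"
proof -
  interpret module "(*) :: 'a line_poly \<Rightarrow> _" by unfold_locales (auto simp: algebra_simps)
  show ?thesis
    using assms(1) unfolding ideal_of_def
    by (induction rule: span_induct_alt) (auto simp: poly_eval_add poly_eval_mult assms(2))
qed

lemma subset_ideal_of: "S \<subseteq> ideal_of S" and zero_in_ideal_of: "0 \<in> ideal_of S"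
proof -
  interpret module "(*) :: 'a \<Rightarrow> _" by unfold_locales (auto simp: algebra_simps)
  show "S \<subseteq> ideal_of S" "0 \<in> ideal_of S"
    unfolding ideal_of_def by (auto intro: span_base span_zero)
qed

text \<open>The generators may be tested instead of the whole ideal, because the polynomials that vanish
  at a fixed tuple of vectors form an ideal.\<close>

lemma poly_eval_tilde_ideal_iff:
  "(\<forall>p\<in>tilde_ideal C c f. poly_eval x p = 0) \<longleftrightarrow>
     (\<forall>p\<in>minors3 (back_matrix C). poly_eval x p = 0) \<and>
     (\<forall>\<sigma>\<in>four_collinear C. poly_eval x (det (Phi C c (f \<sigma>) \<sigma>)) = 0)"
    (is "?l \<longleftrightarrow> ?r1 \<and> ?r2")
proof
  define I where "I \<sigma> = ideal_of {det (Phi C c (f \<sigma>) \<sigma>)}" for \<sigma>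
  have tilde: "tilde_ideal C c f = ideal_of (minors3 (back_matrix C)) + sum I (four_collinear C)"
    by (simp add: tilde_ideal_def I_def)
  have fin: "finite (four_collinear C)" by simp
  have sumI: "sum I (four_collinear C) =
      {\<Sum>\<sigma>\<in>four_collinear C. s \<sigma> | s. \<forall>\<sigma>\<in>four_collinear C. s \<sigma> \<in> I \<sigma>}"
    by (rule set_sum_alt[OF fin])
  {
    assume l: ?l
    have zero: "0 \<in> sum I (four_collinear C)"
      unfolding sumI by (intro CollectI exI[of _ "\<lambda>_. 0"]) (simp add: I_def zero_in_ideal_of)
    then have "p \<in> tilde_ideal C c f" if "p \<in> minors3 (back_matrix C)" for p
      using set_plus_intro[OF subsetD[OF subset_ideal_of that] zero] unfolding tilde by simp
    then have "?r1" using l by blast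
    moreover have "det (Phi C c (f \<sigma>) \<sigma>) \<in> tilde_ideal C c f" if s: "\<sigma> \<in> four_collinear C" for \<sigma>
    proof -
      have "det (Phi C c (f \<sigma>) \<sigma>) \<in> sum I (four_collinear C)"
        unfolding sumI
        by (intro CollectI exI[of _ "\<lambda>\<tau>. if \<tau> = \<sigma> then det (Phi C c (f \<sigma>) \<sigma>) else 0"])
           (use s subset_ideal_of in \<open>auto simp: I_def zero_in_ideal_of\<close>)
      from set_plus_intro[OF zero_in_ideal_of this] show ?thesis
        unfolding tilde by simp
    qed
    then have "?r2" using l by blast
    ultimately show "?r1 \<and> ?r2" by blast
  }
  {
    assume r: "?r1 \<and> ?r2"
    show ?l
    proof
      fix p assume "p \<in> tilde_ideal C c f"
      then obtain q s where p: "p = q + (\<Sum>\<sigma>\<in>four_collinear C. s \<sigma>)"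
        and q: "q \<in> ideal_of (minors3 (back_matrix C))"
        and s: "\<forall>\<sigma>\<in>four_collinear C. s \<sigma> \<in> I \<sigma>"
        unfolding tilde sumI by (auto elim!: set_plus_elim)
      have "poly_eval x q = 0" using poly_eval_ideal_of_eq_0[OF q] r by blast
      moreover have "poly_eval x (s \<sigma>) = 0" if "\<sigma> \<in> four_collinear C" for \<sigma>
        using poly_eval_ideal_of_eq_0[of "s \<sigma>" "{det (Phi C c (f \<sigma>) \<sigma>)}" x] r s that
        by (auto simp: I_def)
      ultimately show "poly_eval x p = 0"
        by (simp add: p poly_eval_add poly_eval_sum)
    qed
  }
qed


section \<open>Zero loci are Zariski closed\<close>

definition multideg :: "((3 \<times> 'm) \<Rightarrow>\<^sub>0 nat) \<Rightarrow> 'm \<Rightarrow> nat" where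
  "multideg u j = (\<Sum>a\<in>UNIV. Poly_Mapping.lookup u (a, j))"

definition multihom_part :: "('m \<Rightarrow> nat) \<Rightarrow> 'm line_poly \<Rightarrow> 'm line_poly" where
  "multihom_part d p = (\<Sum>u\<in>{u \<in> Poly_Mapping.keys p. multideg u = d}.
     Poly_Mapping.single u (Poly_Mapping.lookup p u))"

lemma multihomogeneous_multihom_part: "multihomogeneous (multihom_part d p)"
proof -
  have "Poly_Mapping.lookup (multihom_part d p) u = 0" if "multideg u \<noteq> d" for u
    using that by (auto simp: multihom_part_def lookup_sum lookup_single when_def intro!: sum.neutral)
  then show ?thesis
    unfolding multihomogeneous_def multideg_def
    by (intro exI[of _ d]) (auto simp: in_keys_iff fun_eq_iff)
qed

lemma poly_eval_multihom_part:
  "poly_eval x (multihom_part d p) =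
     (\<Sum>u\<in>{u \<in> Poly_Mapping.keys p. multideg u = d}. Poly_Mapping.lookup p u * monom_eval x u)"
  by (simp add: multihom_part_def poly_eval_sum poly_eval_single)

lemma poly_eval_sum_multihom_parts:
  "poly_eval x p = (\<Sum>d\<in>multideg ` Poly_Mapping.keys p. poly_eval x (multihom_part d p))"
  unfolding poly_eval_multihom_part
  by (subst sum.image_gen[OF finite_keys, symmetric])
     (auto simp: poly_eval_def monom_eval_def)

lemma monom_eval_scale:
  "monom_eval (\<lambda>j. t j *s x j) u = (\<Prod>j\<in>UNIV. t j ^ multideg u j) * monom_eval x u"
proof -
  have "(\<Prod>(a, j)\<in>UNIV. t j ^ Poly_Mapping.lookup u (a, j)) =
      (\<Prod>a\<in>UNIV. \<Prod>j\<in>UNIV. t j ^ Poly_Mapping.lookup u (a, j))"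
    by (subst prod.cartesian_product) simp
  also have "\<dots> = (\<Prod>j\<in>UNIV. t j ^ multideg u j)"
    by (subst prod.swap) (simp add: multideg_def power_sum)
  finally show ?thesis
    by (simp add: monom_eval_def power_mult_distrib case_prod_unfold prod.distrib)
qed

text \<open>Monomials of different multidegrees are linearly independent as functions on the torus of
  scaling factors.  In one scaling factor the sum is a polynomial with infinitely many roots, hence
  zero; the factors are treated one after the other, each time keeping a single exponent.\<close>

lemma torus_sum_eq_0:
  fixes b :: "'u \<Rightarrow> complex" and D :: "'u \<Rightarrow> 'm \<Rightarrow> nat"
  assumes "finite J" "finite K"
    and "\<And>t. (\<And>j. t j \<noteq> 0) \<Longrightarrow> (\<Sum>u\<in>K. b u * (\<Prod>j\<in>J. t j ^ D u j)) = 0"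
  shows "(\<Sum>u\<in>{u \<in> K. \<forall>j\<in>J. D u j = d j}. b u) = 0"
  using assms
proof (induction J arbitrary: K)
  case empty
  show ?case using empty.prems(2)[of "\<lambda>_. 1"] by simp
next
  case (insert i J)
  let ?K = "{u \<in> K. D u i = d i}"
  have "(\<Sum>u\<in>?K. b u * (\<Prod>j\<in>J. t j ^ D u j)) = 0" if t: "\<And>j. t j \<noteq> 0" for t
  proof -
    define g where "g u = b u * (\<Prod>j\<in>J. t j ^ D u j)" for u
    define P where "P = (\<Sum>u\<in>K. monom (g u) (D u i))"
    have "poly P s = 0" if "s \<noteq> 0" for s
    proof -
      have "(\<Prod>j\<in>J. (t(i := s)) j ^ D u j) = (\<Prod>j\<in>J. t j ^ D u j)" for u
        using insert.hyps by (intro prod.cong) auto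
      then have "poly P s = (\<Sum>u\<in>K. b u * (\<Prod>j\<in>insert i J. (t(i := s)) j ^ D u j))"
        using insert.hyps by (simp add: P_def poly_sum poly_monom g_def algebra_simps)
      also have "\<dots> = 0" using t that by (intro insert.prems) auto
      finally show ?thesis .
    qed
    then have "UNIV - {0} \<subseteq> {s. poly P s = 0}" by auto
    moreover have "infinite (UNIV - {0::complex})"
      using infinite_UNIV_char_0 by (simp add: infinite_remove)
    ultimately have "infinite {s. poly P s = 0}" by (rule infinite_super)
    then have "P = 0" using poly_roots_finite by blast
    then have "0 = coeff P (d i)" by simp
    also have "\<dots> = (\<Sum>u\<in>K. if D u i = d i then g u else 0)"
      by (simp add: P_def coeff_sum)
    also have "\<dots> = (\<Sum>u\<in>?K. g u)"
      using insert.prems by (simp add: sum.If_cases Int_def)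
    finally show ?thesis by (simp add: g_def)
  qed
  then have "(\<Sum>u\<in>{u \<in> ?K. \<forall>j\<in>J. D u j = d j}. b u) = 0"
    using insert.prems(1) by (intro insert.IH) auto
  moreover have "{u \<in> ?K. \<forall>j\<in>J. D u j = d j} = {u \<in> K. \<forall>j\<in>insert i J. D u j = d j}"
    by auto
  ultimately show ?case by simp
qed

lemma proj_point_scale:
  assumes "t \<noteq> 0"
  shows "proj_point (t *s v) = proj_point v"
  unfolding proj_point_def by (rule vec.span_image_scale[of "{v}" "\<lambda>_. t", simplified]) (use assms in auto)

text \<open>Vanishing at a point means vanishing at all its representatives, and these form a full torus
  orbit.  This is what separates the multihomogeneous parts.\<close>

lemma vanishes_at_multihom_part:
  assumes "vanishes_at p P"
  shows "vanishes_at (multihom_part d p) P"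
  unfolding vanishes_at_def
proof (intro allI impI)
  fix x assume x: "\<forall>j. proj_point (x j) = P j"
  have "(\<Sum>u\<in>{u \<in> Poly_Mapping.keys p. \<forall>j\<in>UNIV. multideg u j = d j}.
      Poly_Mapping.lookup p u * monom_eval x u) = 0"
  proof (rule torus_sum_eq_0)
    fix t :: "'a \<Rightarrow> complex" assume t: "\<And>j. t j \<noteq> 0"
    have "0 = poly_eval (\<lambda>j. t j *s x j) p"
      using assms x t by (simp add: vanishes_at_def proj_point_scale)
    also have "\<dots> = (\<Sum>u\<in>Poly_Mapping.keys p.
        Poly_Mapping.lookup p u * monom_eval x u * (\<Prod>j\<in>UNIV. t j ^ multideg u j))"
      by (subst poly_eval_superset[OF finite_keys order.refl]) (simp add: monom_eval_scale mult_ac)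
    finally show "\<dots> = 0" by simp
  qed auto
  then show "poly_eval x (multihom_part d p) = 0"
    by (simp add: poly_eval_multihom_part fun_eq_iff)
qed

text \<open>The polynomials that cut out the set need not be multihomogeneous: they can be replaced by their
  multihomogeneous parts.  Hence the determinants in the ideal can be used without
  computing their multidegrees.\<close>

lemma zariski_closed_zero_locus: "zariski_closed (zero_locus S)"
proof -
  let ?T = "{multihom_part d p | d p. p \<in> S}"
  have "vanishes_at p P" if "\<And>d. vanishes_at (multihom_part d p) P" for p P
    using that by (auto simp: vanishes_at_def poly_eval_sum_multihom_parts[of _ p] intro!: sum.neutral)
  then have "zero_locus S = zero_locus ?T"
    unfolding zero_locus_def by (auto intro: vanishes_at_multihom_part) blast
  then show ?thesis
    unfolding zariski_closed_def
    by (intro exI[of _ ?T]) (auto simp: multihomogeneous_multihom_part)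
qed

lemma zero_locus_eq:
  "zero_locus S = {P \<in> multiproj. \<forall>x. (\<forall>j. proj_point (x j) = P j) \<longrightarrow> (\<forall>p\<in>S. poly_eval x p = 0)}"
  by (auto simp: zero_locus_def vanishes_at_def)

section \<open>Linear algebra over the complex numbers\<close>

text \<open>The bilinear pairing, not the Hermitian one: a vector on the left stands for a plane, a vector
  on the right for a point.\<close>

abbreviation dot :: "complex ^ 'n \<Rightarrow> complex ^ 'n \<Rightarrow> complex" (infixl "\<odot>" 70) where
  "u \<odot> v \<equiv> scalar_product u v"

lemma dot_simps:
  fixes u v w :: "complex ^ 'n"
  shows "u \<odot> (v + w) = u \<odot> v + u \<odot> w" "u \<odot> (v - w) = u \<odot> v - u \<odot> w"
    "u \<odot> (t *s v) = t * (u \<odot> v)" "(t *s u) \<odot> v = t * (u \<odot> v)"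
    "(u + w) \<odot> v = u \<odot> v + w \<odot> v" "u \<odot> 0 = 0" "0 \<odot> v = 0"
  by (simp_all add: scalar_product_def sum.distrib sum_subtractf sum_distrib_left algebra_simps)

lemma dot_commute: "(u :: complex ^ 'n) \<odot> v = v \<odot> u"
  by (simp add: scalar_product_def mult.commute)

lemma dot_vector_matrix:
  fixes A :: "complex ^ 'n ^ 'm"
  shows "(x v* A) \<odot> y = x \<odot> (A *v y)"
proof -
  have "(x v* A) \<odot> y = (\<Sum>i\<in>UNIV. \<Sum>j\<in>UNIV. x $ j * (A $ j $ i * y $ i))"
    by (simp add: scalar_product_def vector_matrix_mult_def sum_distrib_left sum_distrib_right algebra_simps)
  also have "\<dots> = x \<odot> (A *v y)"
    by (subst sum.swap)
       (simp add: scalar_product_def matrix_vector_mult_def sum_distrib_left)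
  finally show ?thesis .
qed

lemma dot_eq_0_imp_0:
  assumes "\<And>y. (u :: complex ^ 'n) \<odot> y = 0"
  shows "u = 0"
proof -
  have "u $ i = u \<odot> axis i 1" for i
    by (simp add: scalar_product_def axis_def if_distrib sum.If_cases cong: if_cong)
  then show ?thesis by (simp add: assms vec_eq_iff)
qed

lemma det_eq_0_iff_kernel:
  fixes A :: "complex ^ 'n ^ 'n"
  shows "det A = 0 \<longleftrightarrow> (\<exists>z. z \<noteq> 0 \<and> A *v z = 0)"
proof -
  have "det A \<noteq> 0 \<longleftrightarrow> (\<exists>B. B ** A = mat 1)"
    by (simp add: invertible_det_nz[symmetric] invertible_left_inverse)
  then show ?thesis by (auto simp: matrix_left_invertible_ker)
qed

lemma span_pair:
  "vec.span {a, b} = {\<alpha> *s a + \<beta> *s b | \<alpha> \<beta>. True}"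
proof -
  have "x \<in> vec.span {a, b} \<longleftrightarrow> (\<exists>\<alpha> \<beta>. x = \<alpha> *s a + \<beta> *s b)" for x
  proof -
    have "x \<in> vec.span {a, b} \<longleftrightarrow> (\<exists>\<alpha> \<beta>. x - \<alpha> *s a = \<beta> *s b)"
      by (simp add: vec.span_breakdown_eq[of x a] vec.span_singleton image_iff)
    then show ?thesis by (simp add: diff_eq_eq add.commute)
  qed
  then show ?thesis by auto
qed

text \<open>Linear independence of a family of two vectors; other than for the set \<open>{a, b}\<close>, equal vectors
  count as dependent.\<close>

definition indep2 :: "complex ^ 'n \<Rightarrow> complex ^ 'n \<Rightarrow> bool" where
  "indep2 a b \<longleftrightarrow> (\<forall>\<alpha> \<beta>. \<alpha> *s a + \<beta> *s b = 0 \<longrightarrow> \<alpha> = 0 \<and> \<beta> = 0)"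

lemma indep2D: "indep2 a b \<Longrightarrow> \<alpha> *s a + \<beta> *s b = 0 \<Longrightarrow> \<alpha> = 0 \<and> \<beta> = 0"
  by (simp add: indep2_def)

lemma indep2_iff_independent: "indep2 a b \<longleftrightarrow> a \<noteq> b \<and> vec.independent {a, b}"
proof
  assume i: "indep2 a b"
  have "a \<noteq> b"
    using indep2D[OF i, of 1 "-1"] by auto
  moreover have "b \<noteq> 0"
    using indep2D[OF i, of 0 1] by auto
  moreover have "a \<noteq> k *s b" for k
    using indep2D[OF i, of 1 "- k"] by auto
  ultimately show "a \<noteq> b \<and> vec.independent {a, b}"
    by (auto simp: vec.independent_insert vec.span_singleton)
next
  assume i: "a \<noteq> b \<and> vec.independent {a, b}"
  then have b: "b \<noteq> 0" and a: "\<And>k. a \<noteq> k *s b"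
    by (auto simp: vec.independent_insert vec.span_singleton split: if_splits)
  show "indep2 a b"
    unfolding indep2_def
  proof (intro allI impI)
    fix \<alpha> \<beta> assume eq: "\<alpha> *s a + \<beta> *s b = 0"
    have "\<alpha> = 0"
    proof (rule ccontr)
      assume "\<alpha> \<noteq> 0"
      have "\<alpha> *s a = (- \<beta>) *s b" using eq by (simp add: add_eq_0_iff)
      then have "inverse \<alpha> *s (\<alpha> *s a) = inverse \<alpha> *s ((- \<beta>) *s b)" by (rule arg_cong)
      then have "a = (- \<beta> / \<alpha>) *s b"
        using \<open>\<alpha> \<noteq> 0\<close> by (simp add: vec.scale_scale field_simps)
      then show False using a by blast
    qed
    then show "\<alpha> = 0 \<and> \<beta> = 0" using eq b by auto
  qed
qed

lemma is_line_span_pair: "is_line (vec.span {a, b}) \<longleftrightarrow> indep2 a b"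
proof
  assume "indep2 a b"
  then show "is_line (vec.span {a, b})"
    by (simp add: is_line_def indep2_iff_independent vec.dim_eq_card_independent)
next
  assume "is_line (vec.span {a, b})"
  then have d: "vec.dim {a, b} = 2" by (simp add: is_line_def)
  then have "card {a, b} = 2"
    using vec.dim_le_card'[of "{a, b}"] card_2_iff[of "{a, b}"] card_insert_le_m1[of 2 "{b}" a]
    by (simp add: card_insert_if split: if_splits)
  moreover have "vec.independent {a, b}"
    using vec.card_le_dim_spanning[of "{a, b}" "vec.span {a, b}"] d calculation
    by (simp add: vec.span_superset)
  ultimately show "indep2 a b"
    by (auto simp: indep2_iff_independent)
qed

lemma is_line_basis:
  assumes "is_line E"
  obtains a b where "indep2 a b" "E = vec.span {a, b}"
proof -
  obtain B where B: "B \<subseteq> E" "vec.independent B" "E \<subseteq> vec.span B" "card B = 2"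
    using vec.basis_exists[of E] assms by (auto simp: is_line_def)
  then obtain a b where ab: "B = {a, b}" "a \<noteq> b" by (auto simp: card_2_iff)
  have "vec.span B = E"
    using B assms by (auto simp: is_line_def dest: vec.span_minimal)
  with ab B that show ?thesis by (auto simp: indep2_iff_independent)
qed

lemma is_line_eq_span_pair:
  assumes "is_line E" "a \<in> E" "b \<in> E" "indep2 a b"
  shows "E = vec.span {a, b}"
proof -
  have s: "vec.span {a, b} \<subseteq> E"
    using assms vec.span_minimal[of "{a, b}" E] by (simp add: is_line_def)
  have "vec.dim (vec.span {a, b}) = vec.dim E"
    using assms(1,4) is_line_span_pair[of a b] by (simp add: is_line_def)
  then show ?thesis
    using vec.subspace_dim_equal[OF _ _ s] assms(1) by (auto simp: is_line_def)
qed

lemma proj_point_eq_imp_multiple: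
  assumes "proj_point y = proj_point z" "z \<noteq> 0"
  obtains t where "t \<noteq> 0" "y = t *s z"
proof -
  have self: "v \<in> proj_point v" for v :: "complex ^ 'n"
    by (simp add: proj_point_def vec.span_base)
  have "z \<in> proj_point y" "y \<in> proj_point z"
    using self[of y] self[of z] by (simp_all only: assms(1))
  then have "z \<in> range (\<lambda>k. k *s y)" "y \<in> range (\<lambda>k. k *s z)"
    by (simp_all only: proj_point_def vec.span_singleton)
  then obtain t s where "y = t *s z" "z = s *s y" by blast
  moreover from this have "t \<noteq> 0" using assms(2) by auto
  ultimately show ?thesis using that by blast
qed

lemma indep2_if_proj_point_neq:
  assumes "proj_point a \<noteq> proj_point b" "a \<noteq> 0" "b \<noteq> 0"
  shows "indep2 a b"
proof (rule ccontr)
  assume n: "\<not> indep2 a b"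
  have "a \<noteq> b" using assms by auto
  with n have "\<not> vec.independent {a, b}" by (simp add: indep2_iff_independent)
  then obtain k where k: "a = k *s b"
    using assms \<open>a \<noteq> b\<close> by (auto simp: vec.independent_insert vec.span_singleton)
  then show False using proj_point_scale[of k b] assms by auto
qed

text \<open>A basis of the span, padded with zero rows, gives a singular square matrix, whose kernel
  annihilates the span.\<close>

lemma dim_less_imp_annihilator:
  fixes S :: "(complex ^ 'n) set"
  assumes "vec.dim S < CARD('n)"
  obtains z where "z \<noteq> 0" "\<And>y. y \<in> S \<Longrightarrow> y \<odot> z = 0"
proof -
  obtain B where B: "vec.independent B" "S \<subseteq> vec.span B" "card B = vec.dim S"
    by (rule vec.basis_exists[of S])
  have fB: "finite B" using B(1) by (rule vec.finiteI_independent)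
  then have "card (insert 0 B) \<le> CARD('n)"
    using assms B(3) by (simp add: card_insert_if)
  then obtain g where g: "g ` (insert 0 B) \<subseteq> (UNIV :: 'n set)" "inj_on g (insert 0 B)"
    using card_le_inj[of "insert 0 B" "UNIV :: 'n set"] fB finite[of "UNIV :: 'n set"]
    by (metis finite_insert)
  \<comment> \<open>The row with index \<open>g y\<close> is \<open>y\<close>; as \<open>0\<close> also has an index, there is a zero row.\<close>
  define A :: "complex ^ 'n ^ 'n" where
    "A = (\<chi> i. if i \<in> g ` B then the_inv_into (insert 0 B) g i else 0)"
  have Ag: "A $ g y = y" if "y \<in> insert 0 B" for y
  proof (cases "y \<in> B")
    case True
    then show ?thesis by (simp add: A_def the_inv_into_f_f[OF g(2)])
  next
    case False
    then have "y = 0" "g y \<notin> g ` B" using that inj_on_eq_iff[OF g(2)] by auto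
    then show ?thesis by (simp add: A_def)
  qed
  have "row (g 0) A = 0" using Ag[of 0] by (simp add: row_def vec_eq_iff)
  then have "det A = 0" by (rule det_zero_row)
  then obtain z where z: "z \<noteq> 0" "A *v z = 0" by (auto simp: det_eq_0_iff_kernel)
  have "y \<odot> z = 0" if "y \<in> S" for y
  proof -
    have "u \<odot> z = 0" if "u \<in> B" for u
    proof -
      have "u \<odot> z = (A *v z) $ g u"
        using Ag[of u] that by (simp add: matrix_vector_mult_def scalar_product_def)
      then show ?thesis using z by simp
    qed
    moreover have "vec.subspace {u. u \<odot> z = 0}"
      by (auto simp: vec.subspace_def dot_simps)
    ultimately have "vec.span B \<subseteq> {u. u \<odot> z = 0}"
      by (intro vec.span_minimal) auto
    then show ?thesis using that B(2) by blast
  qed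
  with z(1) that show ?thesis by blast
qed

definition frame :: "complex ^ 4 \<Rightarrow> complex ^ 4 \<Rightarrow> complex ^ 4 \<Rightarrow> complex ^ 4 \<Rightarrow> complex ^ 4 ^ 4" where
  "frame a b u v = (\<chi> i j. if j = 1 then a $ i else if j = 2 then b $ i else if j = 3 then u $ i else v $ i)"

lemma vector_4 [simp]:
  "(vector [x, y, z, w] :: 'a::zero ^ 4) $ 1 = x" "(vector [x, y, z, w] :: 'a ^ 4) $ 2 = y"
  "(vector [x, y, z, w] :: 'a ^ 4) $ 3 = z" "(vector [x, y, z, w] :: 'a ^ 4) $ 4 = w"
  unfolding vector_def by simp_all

lemma frame_mult:
  "frame a b u v *v z = z $ 1 *s a + z $ 2 *s b + z $ 3 *s u + z $ 4 *s v"
  by (simp add: frame_def matrix_vector_mult_def vec_eq_iff sum_4 algebra_simps)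

lemma frame_inverse:
  assumes "indep2 a b" "indep2 u v" "vec.span {a, b} \<inter> vec.span {u, v} = {0}"
  obtains T where "T ** frame a b u v = mat 1" "frame a b u v ** T = mat 1"
proof -
  have "z = 0" if z: "frame a b u v *v z = 0" for z
  proof -
    let ?y = "z $ 1 *s a + z $ 2 *s b"
    have "?y - (- z $ 3 *s u + - z $ 4 *s v) = 0"
      using z by (simp add: frame_mult algebra_simps del: right_minus_eq)
    then have "?y = - z $ 3 *s u + - z $ 4 *s v" by (rule right_minus_eq[THEN iffD1])
    moreover from this have "?y \<in> vec.span {u, v}" unfolding span_pair by blast
    moreover have "?y \<in> vec.span {a, b}" unfolding span_pair by blast
    ultimately have "?y \<in> {0}" using assms(3) by blast
    moreover from this have "- z $ 3 *s u + - z $ 4 *s v = 0"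
      using \<open>?y = - z $ 3 *s u + - z $ 4 *s v\<close> by simp
    ultimately show ?thesis
      using indep2D[OF assms(1), of "z $ 1" "z $ 2"] indep2D[OF assms(2), of "- z $ 3" "- z $ 4"]
      by (simp add: vec_eq_iff[of z] forall_4)
  qed
  then obtain T where "T ** frame a b u v = mat 1"
    using matrix_left_invertible_ker by blast
  with that show ?thesis by (simp add: matrix_left_right_inverse)
qed

lemma span_scale_iff: "t *s x \<in> vec.span S \<longleftrightarrow> t = 0 \<or> (x :: complex ^ 'n) \<in> vec.span S"
proof -
  have "inverse t *s (t *s x) \<in> vec.span S" if "t *s x \<in> vec.span S"
    using that by (rule vec.span_scale)
  then show ?thesis by (cases "t = 0") (auto simp: vec.span_scale vec.span_zero vec.scale_scale)
qed

lemma complement_exists: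
  assumes "indep2 a b"
  obtains u v :: "complex ^ 4" where "indep2 u v" "vec.span {a, b} \<inter> vec.span {u, v} = {0}"
proof -
  have *: "\<exists>y. y \<notin> vec.span S" if "finite S" "card S < 4" for S :: "(complex ^ 4) set"
  proof -
    have "vec.dim (vec.span S) < 4"
      using vec.dim_le_card'[OF that(1)] that(2) by simp
    moreover have "vec.dim (UNIV :: (complex ^ 4) set) = 4"
      by (subst vec_dim_card) simp
    ultimately have "vec.span S \<noteq> UNIV" by (metis less_irrefl)
    then show ?thesis by blast
  qed
  obtain u where u: "u \<notin> vec.span {a, b}"
    using *[of "{a, b}"] card_length[of "[a, b]"] by fastforce
  obtain v where v: "v \<notin> vec.span {u, a, b}"
    using *[of "{u, a, b}"] card_length[of "[u, a, b]"] by fastforce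
  have zero: "\<gamma> = 0 \<and> \<delta> = 0" if "\<gamma> *s u + \<delta> *s v \<in> vec.span {a, b}" for \<gamma> \<delta>
  proof -
    have sub: "vec.span {a, b} \<subseteq> vec.span {u, a, b}" by (rule vec.span_mono) auto
    have "\<gamma> *s u \<in> vec.span {u, a, b}" by (simp add: vec.span_scale vec.span_base)
    with that sub have "(\<gamma> *s u + \<delta> *s v) - \<gamma> *s u \<in> vec.span {u, a, b}"
      by (intro vec.span_diff) auto
    then have "\<delta> = 0" using v by (simp add: span_scale_iff)
    then show ?thesis using that u by (auto simp: span_scale_iff)
  qed
  show ?thesis
  proof (rule that)
    show "indep2 u v"
      unfolding indep2_def using zero vec.span_zero by metis
    have "y = 0" if "y \<in> vec.span {a, b}" "y \<in> vec.span {u, v}" for y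
    proof -
      from that(2) obtain \<gamma> \<delta> where y: "y = \<gamma> *s u + \<delta> *s v" by (auto simp: span_pair)
      with zero[of \<gamma> \<delta>] that(1) have "\<gamma> = 0 \<and> \<delta> = 0" by blast
      with y show "y = 0" by simp
    qed
    then show "vec.span {a, b} \<inter> vec.span {u, v} = {0}"
      using vec.span_zero by blast
  qed
qed

section \<open>Quadrics\<close>

lemma exhaust_10:
  fixes x :: 10
  shows "x = 1 \<or> x = 2 \<or> x = 3 \<or> x = 4 \<or> x = 5 \<or> x = 6 \<or> x = 7 \<or> x = 8 \<or> x = 9 \<or> x = 10"
proof (induct x)
  case (of_int z)
  then have "0 \<le> z" and "z < 10" by simp_all
  then have "z = 0 \<or> z = 1 \<or> z = 2 \<or> z = 3 \<or> z = 4 \<or> z = 5 \<or> z = 6 \<or> z = 7 \<or> z = 8 \<or> z = 9" by arith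
  then show ?case by auto
qed

lemma forall_10: "(\<forall>i::10. P i) \<longleftrightarrow> P 1 \<and> P 2 \<and> P 3 \<and> P 4 \<and> P 5 \<and> P 6 \<and> P 7 \<and> P 8 \<and> P 9 \<and> P 10"
  by (metis exhaust_10)

lemma sum_10: "sum g (UNIV :: 10 set) = g 1 + g 2 + g 3 + g 4 + g 5 + g 6 + g 7 + g 8 + g 9 + g 10"
proof -
  have U: "UNIV = {1, 2, 3, 4, 5, 6, 7, 8, 9, 10 :: 10}" using exhaust_10 by auto
  show ?thesis unfolding U by (simp add: add.assoc)
qed

lemma vector_10 [simp]:
  shows "(vector [x1, x2, x3, x4, x5, x6, x7, x8, x9, x10] :: 'a::zero ^ 10) $ 1 = x1"
    "(vector [x1, x2, x3, x4, x5, x6, x7, x8, x9, x10] :: 'a::zero ^ 10) $ 2 = x2"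
    "(vector [x1, x2, x3, x4, x5, x6, x7, x8, x9, x10] :: 'a::zero ^ 10) $ 3 = x3"
    "(vector [x1, x2, x3, x4, x5, x6, x7, x8, x9, x10] :: 'a::zero ^ 10) $ 4 = x4"
    "(vector [x1, x2, x3, x4, x5, x6, x7, x8, x9, x10] :: 'a::zero ^ 10) $ 5 = x5"
    "(vector [x1, x2, x3, x4, x5, x6, x7, x8, x9, x10] :: 'a::zero ^ 10) $ 6 = x6"
    "(vector [x1, x2, x3, x4, x5, x6, x7, x8, x9, x10] :: 'a::zero ^ 10) $ 7 = x7"
    "(vector [x1, x2, x3, x4, x5, x6, x7, x8, x9, x10] :: 'a::zero ^ 10) $ 8 = x8"
    "(vector [x1, x2, x3, x4, x5, x6, x7, x8, x9, x10] :: 'a::zero ^ 10) $ 9 = x9"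
    "(vector [x1, x2, x3, x4, x5, x6, x7, x8, x9, x10] :: 'a::zero ^ 10) $ 10 = x10"
  unfolding vector_def by simp_all

text \<open>The quadratic form with coefficient vector \<open>q\<close>, in the order of the Veronese map \<open>nu\<close>.\<close>

definition quad :: "complex ^ 10 \<Rightarrow> complex ^ 4 \<Rightarrow> complex" where
  "quad q z = q \<odot> nu z"

lemma quad_expand:
  "quad q z = q $ 1 * (z $ 1)\<^sup>2 + q $ 2 * (z $ 2)\<^sup>2 + q $ 3 * (z $ 3)\<^sup>2 + q $ 4 * (z $ 4)\<^sup>2
     + q $ 5 * (z $ 1 * z $ 2) + q $ 6 * (z $ 1 * z $ 3) + q $ 7 * (z $ 1 * z $ 4)
     + q $ 8 * (z $ 2 * z $ 3) + q $ 9 * (z $ 2 * z $ 4) + q $ 10 * (z $ 3 * z $ 4)"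
  by (simp add: quad_def scalar_product_def nu_def Let_def sum_10)

text \<open>The determinant vanishes if and only if its rows are dependent, and a linear relation
  between the rows is a quadric through the ten points.\<close>

lemma det_nu_columns_eq_0_iff:
  fixes v1 :: "complex ^ 4"
  shows "det (transpose (vector (map nu [v1, v2, v3, v4, v5, v6, v7, v8, v9, v10])) :: complex ^ 10 ^ 10) = 0
     \<longleftrightarrow> (\<exists>q. q \<noteq> 0 \<and> (\<forall>z\<in>{v1, v2, v3, v4, v5, v6, v7, v8, v9, v10}. quad q z = 0))"
proof -
  let ?A = "vector (map nu [v1, v2, v3, v4, v5, v6, v7, v8, v9, v10]) :: complex ^ 10 ^ 10"
  have "(?A *v q) $ k = q \<odot> (?A $ k)" for q k
    by (simp add: matrix_vector_mult_def scalar_product_def mult.commute)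
  then have "?A *v q = 0 \<longleftrightarrow> (\<forall>k. q \<odot> (?A $ k) = 0)" for q
    by (simp add: vec_eq_iff)
  moreover have "(\<forall>k. q \<odot> (?A $ k) = 0) \<longleftrightarrow>
      (\<forall>z\<in>{v1, v2, v3, v4, v5, v6, v7, v8, v9, v10}. quad q z = 0)" for q
    unfolding forall_10 quad_def by simp
  ultimately show ?thesis
    by (simp add: det_eq_0_iff_kernel)
qed

lemma quad_eq_0_imp_0:
  assumes "\<And>z. quad q z = 0"
  shows "q = 0"
proof -
  let ?e = "\<lambda>x y z w. vector [x, y, z, w] :: complex ^ 4"
  have 1: "q $ 1 = 0" "q $ 2 = 0" "q $ 3 = 0" "q $ 4 = 0"
    using assms[of "?e 1 0 0 0"] assms[of "?e 0 1 0 0"] assms[of "?e 0 0 1 0"] assms[of "?e 0 0 0 1"]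
    by (simp_all add: quad_expand)
  have "q $ 5 = 0" "q $ 6 = 0" "q $ 7 = 0" "q $ 8 = 0" "q $ 9 = 0" "q $ 10 = 0"
    using assms[of "?e 1 1 0 0"] assms[of "?e 1 0 1 0"] assms[of "?e 1 0 0 1"]
      assms[of "?e 0 1 1 0"] assms[of "?e 0 1 0 1"] assms[of "?e 0 0 1 1"]
    by (simp_all add: quad_expand 1)
  with 1 show ?thesis by (simp add: vec_eq_iff forall_10)
qed

lemma matrix_form_is_quad: "\<exists>q. \<forall>z. z \<odot> (S *v z) = quad q z"
proof (intro exI allI)
  fix z
  show "z \<odot> (S *v z) = quad (vector [S $ 1 $ 1, S $ 2 $ 2, S $ 3 $ 3, S $ 4 $ 4,
      S $ 1 $ 2 + S $ 2 $ 1, S $ 1 $ 3 + S $ 3 $ 1, S $ 1 $ 4 + S $ 4 $ 1,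
      S $ 2 $ 3 + S $ 3 $ 2, S $ 2 $ 4 + S $ 4 $ 2, S $ 3 $ 4 + S $ 4 $ 3]) z"
    by (simp add: scalar_product_def matrix_vector_mult_def sum_4 quad_expand power2_eq_square algebra_simps)
qed

lemma quad_has_matrix: "\<exists>S. \<forall>z. quad q z = z \<odot> (S *v z)"
proof -
  define S :: "complex ^ 4 ^ 4" where
    "S = vector [vector [q $ 1, q $ 5, q $ 6, q $ 7], vector [0, q $ 2, q $ 8, q $ 9],
       vector [0, 0, q $ 3, q $ 10], vector [0, 0, 0, q $ 4]]"
  have "quad q z = z \<odot> (S *v z)" for z
    by (simp add: S_def scalar_product_def matrix_vector_mult_def sum_4 quad_expand power2_eq_square algebra_simps)
  then show ?thesis by blast
qed

lemma quad_change_of_basis: "\<exists>q'. \<forall>z. quad q (G *v z) = quad q' z"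
proof -
  obtain S where S: "\<And>z. quad q z = z \<odot> (S *v z)" using quad_has_matrix by blast
  have "quad q (G *v z) = z \<odot> ((transpose G ** S ** G) *v z)" for z
  proof -
    have "quad q (G *v z) = (z v* transpose G) \<odot> (S *v (G *v z))"
      by (simp add: S)
    also have "\<dots> = z \<odot> ((transpose G ** S ** G) *v z)"
      unfolding dot_vector_matrix by (simp only: matrix_vector_mul_assoc matrix_mul_assoc)
    finally show ?thesis .
  qed
  then show ?thesis using matrix_form_is_quad[of "transpose G ** S ** G"] by auto
qed

text \<open>The existence of a quadric through given points is independent of the coordinate system.  This
  allows computing in coordinates that are adapted to the two skew lines.\<close>

lemma quadric_in_frame:
  fixes G T :: "complex ^ 4 ^ 4"
  assumes "T ** G = mat 1" "G ** T = mat 1"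
  shows "(\<exists>q. q \<noteq> 0 \<and> (\<forall>z\<in>Z. quad q (G *v z) = 0)) \<longleftrightarrow> (\<exists>q. q \<noteq> 0 \<and> (\<forall>z\<in>Z. quad q z = 0))"
proof
  assume "\<exists>q. q \<noteq> 0 \<and> (\<forall>z\<in>Z. quad q (G *v z) = 0)"
  then obtain q where q: "q \<noteq> 0" "\<forall>z\<in>Z. quad q (G *v z) = 0" by blast
  obtain q' where q': "\<forall>z. quad q (G *v z) = quad q' z" using quad_change_of_basis by blast
  have "q' \<noteq> 0"
  proof
    assume "q' = 0"
    then have "quad q (G *v (T *v z)) = 0" for z
      using q' by (simp add: quad_def dot_simps)
    then have "quad q z = 0" for z
      by (simp add: matrix_vector_mul_assoc assms)
    then show False using quad_eq_0_imp_0 q(1) by blast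
  qed
  with q q' show "\<exists>q. q \<noteq> 0 \<and> (\<forall>z\<in>Z. quad q z = 0)" by auto
next
  assume "\<exists>q. q \<noteq> 0 \<and> (\<forall>z\<in>Z. quad q z = 0)"
  then obtain q where q: "q \<noteq> 0" "\<forall>z\<in>Z. quad q z = 0" by blast
  obtain q' where q': "\<forall>z. quad q (T *v z) = quad q' z" using quad_change_of_basis by blast
  have G: "quad q' (G *v z) = quad q z" for z
    using q' by (simp add: matrix_vector_mul_assoc assms flip: spec[OF q'])
  have "q' \<noteq> 0"
  proof
    assume "q' = 0"
    then have "quad q z = 0" for z
      using G[of z] by (simp add: quad_def dot_simps)
    then show False using quad_eq_0_imp_0 q(1) by blast
  qed
  with q G show "\<exists>q. q \<noteq> 0 \<and> (\<forall>z\<in>Z. quad q (G *v z) = 0)" by auto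
qed

text \<open>A nonzero binary quadratic form has at most two zeros on the projective line.  The three linear
  equations for the coefficients have a homogeneous Vandermonde determinant, which is up to sign
  the product \<open>?V\<close> of the three cross terms.\<close>

lemma binary_form_eq_0:
  fixes A B D :: complex
  assumes "A * x1\<^sup>2 + B * y1\<^sup>2 + D * (x1 * y1) = 0" "A * x2\<^sup>2 + B * y2\<^sup>2 + D * (x2 * y2) = 0"
    "A * x3\<^sup>2 + B * y3\<^sup>2 + D * (x3 * y3) = 0"
    and "x1 * y2 - x2 * y1 \<noteq> 0" "x1 * y3 - x3 * y1 \<noteq> 0" "x2 * y3 - x3 * y2 \<noteq> 0"
  shows "A = 0 \<and> B = 0 \<and> D = 0"
proof -
  let ?V = "(x1 * y2 - x2 * y1) * (x1 * y3 - x3 * y1) * (x2 * y3 - x3 * y2)"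
  have V: "?V \<noteq> 0" using assms(4-6) by simp
  have "A * ?V = 0" "B * ?V = 0" "D * ?V = 0"
    using assms(1-3) by algebra+
  then show ?thesis using V by (simp only: mult_eq_0_iff simp_thms)
qed

text \<open>The points \<open>(x i, y i, 0, 0)\<close> lie on one line and the three points of the second set on a skew
  one.  A quadric through three points of a line contains it.  Thus only the four mixed coefficients
  survive, that is, a bilinear form on the product of the two lines, and passing through
  \<open>(x i, y i, p i, r i)\<close> is a linear condition on it.\<close>

lemma quadric_through_skew_lines:
  fixes x y p r :: "nat \<Rightarrow> complex" and s t :: complex
  assumes "x 0 * y 1 - x 1 * y 0 \<noteq> 0" "x 0 * y 2 - x 2 * y 0 \<noteq> 0" "x 1 * y 2 - x 2 * y 1 \<noteq> 0"
    and "s \<noteq> 0" "t \<noteq> 0"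
  defines "Z \<equiv> (\<lambda>i. vector [x i, y i, 0, 0]) ` {0, 1, 2} \<union>
      {vector [0, 0, 1, 0], vector [0, 0, 0, 1], vector [0, 0, s, t]} \<union>
      (\<lambda>i. vector [x i, y i, p i, r i]) ` {0, 1, 2, 3}"
  shows "(\<exists>q. q \<noteq> 0 \<and> (\<forall>z\<in>Z. quad q z = 0)) \<longleftrightarrow>
    (\<exists>w :: complex ^ 4. w \<noteq> 0 \<and> (\<forall>i\<in>{0, 1, 2, 3}.
        w $ 1 * (x i * p i) + w $ 2 * (x i * r i) + w $ 3 * (y i * p i) + w $ 4 * (y i * r i) = 0))"
    (is "?l \<longleftrightarrow> ?r")
proof
  assume ?l
  then obtain q where q: "q \<noteq> 0" "\<And>z. z \<in> Z \<Longrightarrow> quad q z = 0" by blast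
  have c: "quad q (vector [x i, y i, 0, 0]) = 0" if "i \<in> {0, 1, 2}" for i
    using that by (intro q) (auto simp: Z_def)
  have e: "quad q (vector [x i, y i, p i, r i]) = 0" if "i \<in> {0, 1, 2, 3}" for i
    using that by (intro q) (auto simp: Z_def)
  have "q $ 1 = 0 \<and> q $ 2 = 0 \<and> q $ 5 = 0"
    using c[of 0] c[of 1] c[of 2]
    by (intro binary_form_eq_0[OF _ _ _ assms(1-3)]) (simp_all add: quad_expand)
  moreover have "q $ 3 = 0 \<and> q $ 4 = 0 \<and> q $ 10 = 0"
  proof -
    have "quad q (vector [0, 0, 1, 0]) = 0" "quad q (vector [0, 0, 0, 1]) = 0"
      "quad q (vector [0, 0, s, t]) = 0" by (auto intro!: q simp: Z_def)
    then show ?thesis using assms(4,5) by (simp add: quad_expand)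
  qed
  ultimately have z: "q $ 1 = 0" "q $ 2 = 0" "q $ 3 = 0" "q $ 4 = 0" "q $ 5 = 0" "q $ 10 = 0"
    by blast+
  define w :: "complex ^ 4" where "w = vector [q $ 6, q $ 7, q $ 8, q $ 9]"
  have "w \<noteq> 0"
  proof
    assume "w = 0"
    then have "w $ 1 = 0" "w $ 2 = 0" "w $ 3 = 0" "w $ 4 = 0" by simp_all
    then show False using q(1) z by (simp add: w_def vec_eq_iff[of q] forall_10)
  qed
  moreover have "w $ 1 * (x i * p i) + w $ 2 * (x i * r i) + w $ 3 * (y i * p i) + w $ 4 * (y i * r i) = 0"
    if "i \<in> {0, 1, 2, 3}" for i
    using e[OF that] by (simp add: quad_expand z w_def)
  ultimately show ?r by blast
next
  assume ?r
  then obtain w :: "complex ^ 4" where w: "w \<noteq> 0" "\<And>i. i \<in> {0, 1, 2, 3} \<Longrightarrow>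
      w $ 1 * (x i * p i) + w $ 2 * (x i * r i) + w $ 3 * (y i * p i) + w $ 4 * (y i * r i) = 0"
    by blast
  define q :: "complex ^ 10" where "q = vector [0, 0, 0, 0, 0, w $ 1, w $ 2, w $ 3, w $ 4, 0]"
  have "q \<noteq> 0"
  proof
    assume "q = 0"
    then have "q $ 6 = 0" "q $ 7 = 0" "q $ 8 = 0" "q $ 9 = 0" by simp_all
    then show False using w(1) by (simp add: q_def vec_eq_iff[of w] forall_4)
  qed
  moreover have "quad q z = 0" if "z \<in> Z" for z
  proof -
    have "quad q (vector [x i, y i, p i, r i]) = 0" if "i \<in> {0, 1, 2, 3}" for i
      using w(2)[OF that] by (simp add: quad_expand q_def)
    moreover have "quad q (vector [u, v, 0, 0]) = 0" "quad q (vector [0, 0, u, v]) = 0" for u v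
      by (simp_all add: quad_expand q_def)
    ultimately show ?thesis using that unfolding Z_def by blast
  qed
  ultimately show ?l by blast
qed

section \<open>The minors\<close>

lemma poly_eval_back_plane: "poly_eval x (back_plane C i $ a) = (x i v* C i) $ a"
  by (simp add: back_plane_def matrix_vector_mult_def poly_eval_sum poly_eval_mult map_matrix_def
      line_var_def transpose_def vector_matrix_mult_def mult.commute)

lemma minors3_vanish_iff:
  fixes C :: "'m::{finite,linorder} \<Rightarrow> complex ^ 4 ^ 3"
  shows "(\<forall>p\<in>minors3 (back_matrix C). poly_eval x p = 0) \<longleftrightarrow>
    (\<forall>(r :: 3 \<Rightarrow> 4) (k :: 3 \<Rightarrow> 'm). strict_mono r \<and> strict_mono k \<longrightarrow>
      det (\<chi> a b. (x (k b) v* C (k b)) $ r a) = 0)"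
proof -
  have "poly_eval x (det (\<chi> a b. back_matrix C $ r a $ k b :: 'm line_poly ^ 3 ^ 3)) =
      det (\<chi> a b. (x (k b) v* C (k b)) $ r a)" for r :: "3 \<Rightarrow> 4" and k :: "3 \<Rightarrow> 'm"
    by (simp add: poly_eval_det map_matrix_def back_matrix_def poly_eval_back_plane)
  from this[symmetric] show ?thesis unfolding minors3_def by (simp only:) blast
qed

lemma less_3 [simp]: "(0 :: 3) < 1" "(0 :: 3) < 2" "(1 :: 3) < 2" "\<not> (1 :: 3) < 0" "\<not> (2 :: 3) < 0" "\<not> (2 :: 3) < 1"
  by (simp_all add: less_bit1_def bit1.Rep_0 bit1.Rep_1 bit1.Rep_numeral)

lemma exists_strict_mono_3:
  fixes S :: "'c::linorder set"
  assumes "card S = 3"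
  obtains k :: "3 \<Rightarrow> 'c" where "strict_mono k" "range k = S"
proof -
  have "finite S" using assms card.infinite by fastforce
  define l where "l = sorted_list_of_set S"
  have l: "set l = S" "sorted_wrt (<) l" "length l = 3"
    using \<open>finite S\<close> assms by (simp_all add: l_def)
  then obtain x y z where xyz: "l = [x, y, z]"
    by (auto simp: numeral_3_eq_3 length_Suc_conv)
  define k :: "3 \<Rightarrow> 'c" where "k a = (if a = 0 then x else if a = 1 then y else z)" for a
  have ex: "a = 0 \<or> a = 1 \<or> a = 2" for a :: 3 using exhaust_3[of a] by auto
  have "strict_mono k"
  proof (rule strict_monoI)
    fix a b :: 3 assume "a < b"
    then show "k a < k b"
      using ex[of a] ex[of b] l(2) by (auto simp: k_def xyz)
  qed
  moreover have "range k = S"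
  proof -
    have "UNIV = {0, 1, 2 :: 3}" using ex by auto
    then have "range k = k ` {0, 1, 2}" by (rule arg_cong)
    also have "\<dots> = {k 0, k 1, k 2}" by simp
    also have "\<dots> = S" using l(1) by (simp add: k_def xyz)
    finally show ?thesis .
  qed
  ultimately show ?thesis by (rule that)
qed

text \<open>The common line contains a point in the coordinate hyperplane that belongs to the omitted row.
  Its remaining coordinates are a linear relation between the rows of the minor.\<close>

lemma minors_vanish_if_common_line:
  fixes h :: "3 \<Rightarrow> complex ^ 4" and r :: "3 \<Rightarrow> 4"
  assumes "indep2 a b" "\<And>i. h i \<odot> a = 0" "\<And>i. h i \<odot> b = 0" "inj r"
  shows "det (\<chi> i j. h j $ r i) = 0"
proof -
  have "card (range r) = 3" using card_image[OF assms(4)] by simp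
  then have "range r \<noteq> UNIV" by auto
  then obtain s where s: "s \<notin> range r" by blast
  have U: "UNIV = insert s (range r)"
  proof (rule card_subset_eq[symmetric])
    show "card (insert s (range r)) = CARD(4)" using s \<open>card (range r) = 3\<close> by simp
  qed auto
  obtain y where y: "y \<noteq> 0" "y $ s = 0" "\<And>i. h i \<odot> y = 0"
  proof (cases "a $ s = 0")
    case True
    have "a \<noteq> 0" using indep2D[OF assms(1), of 1 0] by auto
    with True assms that show ?thesis by blast
  next
    case False
    show ?thesis
    proof (rule that[of "b $ s *s a - a $ s *s b"])
      show "b $ s *s a - a $ s *s b \<noteq> 0"
        using indep2D[OF assms(1), of "b $ s" "- a $ s"] False by auto
    qed (simp_all add: assms dot_simps)
  qed
  define z :: "complex ^ 3" where "z = (\<chi> i. y $ r i)"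
  have "z \<noteq> 0"
  proof
    assume "z = 0"
    then have "y $ t = 0" if "t \<in> insert s (range r)" for t
      using that y(2) by (auto simp: z_def vec_eq_iff)
    then have "y = 0" using U by (metis UNIV_I vec_eq_iff zero_index)
    with y(1) show False ..
  qed
  moreover have "transpose (\<chi> i j. h j $ r i) *v z = 0"
  proof -
    have "(\<Sum>i\<in>UNIV. h j $ r i * y $ r i) = 0" for j
    proof -
      have "0 = (\<Sum>t\<in>insert s (range r). h j $ t * y $ t)"
        using y(3)[of j] U by (simp add: scalar_product_def)
      also have "\<dots> = (\<Sum>t\<in>range r. h j $ t * y $ t)"
        using s y(2) by simp
      also have "\<dots> = (\<Sum>i\<in>UNIV. h j $ r i * y $ r i)"
        by (subst sum.reindex[OF assms(4)]) simp
      finally show ?thesis by simp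
    qed
    then show ?thesis
      by (simp add: vec_eq_iff matrix_vector_mult_def transpose_def z_def del: transpose_matrix_vector)
  qed
  ultimately show ?thesis
    using det_eq_0_iff_kernel[of "transpose (\<chi> i j. h j $ r i)"] by (auto simp: det_transpose simp del: transpose_matrix_vector)
qed

text \<open>If three of the vectors were independent, then for every coordinate \<open>s\<close> the minor that omits the
  row \<open>s\<close> would give a nontrivial combination of the three that is a multiple of the unit vector
  \<open>axis s 1\<close>.  So the three would span the whole space.\<close>

lemma dim_le_2_if_minors_vanish:
  fixes h :: "'m::{finite,linorder} \<Rightarrow> complex ^ 4"
  assumes "\<And>(r :: 3 \<Rightarrow> 4) (k :: 3 \<Rightarrow> 'm). strict_mono r \<Longrightarrow> strict_mono k \<Longrightarrow>
      det (\<chi> a b. h (k b) $ r a) = 0"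
  shows "vec.dim (range h) \<le> 2"
proof (rule ccontr)
  assume n: "\<not> vec.dim (range h) \<le> 2"
  obtain B where B: "B \<subseteq> range h" "vec.independent B" "card B = vec.dim (range h)"
    by (rule vec.basis_exists[of "range h"])
  have "3 \<le> card B" using n B(3) by simp
  then obtain B3 where B3: "B3 \<subseteq> B" "card B3 = 3"
    by (rule obtain_subset_with_card_n)
  have ind: "vec.independent B3" using B(2) B3(1) by (rule vec.independent_mono)
  obtain I where I: "inj_on h I" "h ` I = B3"
    using subset_image_inj[of B3 h UNIV] B3 B(1) by auto
  then have "card I = 3" using B3(2) card_image by fastforce
  then obtain k :: "3 \<Rightarrow> 'm" where k: "strict_mono k" "range k = I"
    by (rule exists_strict_mono_3)
  have inj: "inj (h \<circ> k)"
    using strict_mono_imp_inj_on[OF k(1)] I(1) k(2) by (intro comp_inj_on) auto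
  have B3k: "range (h \<circ> k) = B3" using I k by auto
  have "axis s 1 \<in> vec.span B3" for s :: 4
  proof -
    have "card (UNIV - {s}) = 3" by simp
    then obtain r :: "3 \<Rightarrow> 4" where r: "strict_mono r" "range r = UNIV - {s}"
      by (rule exists_strict_mono_3)
    obtain z :: "complex ^ 3" where z: "z \<noteq> 0" "(\<chi> a b. h (k b) $ r a) *v z = 0"
      using assms[OF r(1) k(1)] by (auto simp: det_eq_0_iff_kernel)
    define y where "y = (\<Sum>b\<in>UNIV. z $ b *s h (k b))"
    have y_span: "y \<in> vec.span B3"
      unfolding y_def using B3k by (intro vec.span_sum vec.span_scale vec.span_base) auto
    have "y $ t = 0" if "t \<noteq> s" for t
    proof -
      from that r(2) obtain a where "t = r a" by blast
      then have "y $ t = ((\<chi> a b. h (k b) $ r a) *v z) $ a"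
        by (simp add: y_def matrix_vector_mult_def mult.commute)
      then show ?thesis using z(2) by simp
    qed
    then have y_axis: "y = y $ s *s axis s 1"
      by (simp add: vec_eq_iff axis_def)
    have "y \<noteq> 0"
    proof
      assume "y = 0"
      define w where "w v = z $ (the_inv (h \<circ> k) v)" for v
      have "(\<Sum>v\<in>B3. w v *s v) = (\<Sum>b\<in>UNIV. w ((h \<circ> k) b) *s (h \<circ> k) b)"
        unfolding B3k[symmetric] by (subst sum.reindex[OF inj]) simp
      also have "\<dots> = y"
        unfolding y_def w_def using the_inv_f_f[OF inj] by simp
      finally have "(\<Sum>v\<in>B3. w v *s v) = 0" using \<open>y = 0\<close> by simp
      then have "w v = 0" if "v \<in> B3" for v
        using vec.independentD[OF ind _ subset_refl, of w v] that B3(2) card.infinite by fastforce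
      then have "z $ b = 0" for b
        using B3k the_inv_f_f[OF inj, of b] by (metis rangeI w_def)
      with z(1) show False by (simp add: vec_eq_iff)
    qed
    with y_axis have "y $ s \<noteq> 0" by auto
    with y_span y_axis show ?thesis by (metis span_scale_iff)
  qed
  then have "y \<in> vec.span B3" for y :: "complex ^ 4"
    by (subst basis_expansion[symmetric]) (intro vec.span_sum vec.span_scale)
  then have "vec.span B3 = UNIV" by blast
  then have "vec.dim B3 = vec.dim (UNIV :: (complex ^ 4) set)" by (metis vec.dim_span)
  also have "\<dots> = 4" by (subst vec_dim_card) simp
  finally show False using vec.dim_eq_card_independent[OF ind] B3(2) by simp
qed

lemma common_line_if_dim_le_2:
  fixes H :: "(complex ^ 4) set"
  assumes "vec.dim H \<le> 2"
  obtains a b where "indep2 a b" "\<And>h. h \<in> H \<Longrightarrow> h \<odot> a = 0" "\<And>h. h \<in> H \<Longrightarrow> h \<odot> b = 0"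
proof -
  obtain a where a: "a \<noteq> 0" "\<And>h. h \<in> H \<Longrightarrow> h \<odot> a = 0"
    using dim_less_imp_annihilator[of H] assms by auto
  then obtain s where s: "a $ s \<noteq> 0" by (auto simp: vec_eq_iff)
  \<comment> \<open>Adding the equation \<open>z $ s = 0\<close> forces the second solution to be independent of \<open>a\<close>.\<close>
  have "vec.dim (insert (axis s 1) H) < CARD(4)"
    using assms by (simp add: vec.dim_insert)
  then obtain b where b: "b \<noteq> 0" "\<And>h. h \<in> insert (axis s 1) H \<Longrightarrow> h \<odot> b = 0"
    by (rule dim_less_imp_annihilator) blast
  have "axis s 1 \<odot> b = b $ s"
    by (simp add: scalar_product_def axis_def if_distrib if_distribR sum.If_cases cong: if_cong)
  with b(2) have "b $ s = 0" by simp
  have "indep2 a b"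
    unfolding indep2_def
  proof (intro allI impI)
    fix \<alpha> \<beta> assume eq: "\<alpha> *s a + \<beta> *s b = 0"
    then have "\<alpha> * a $ s + \<beta> * b $ s = 0" by (metis vector_add_component vector_smult_component zero_index)
    with s \<open>b $ s = 0\<close> have "\<alpha> = 0" by simp
    with eq b(1) show "\<alpha> = 0 \<and> \<beta> = 0" by simp
  qed
  with a(2) b(2) that show ?thesis by blast
qed

section \<open>The determinants\<close>

text \<open>The value of \<open>e_vec\<close> at a tuple for which the back-projected plane is \<open>h\<close>.  It is \<open>z\<close> plus a
  vector that spans the intersection of \<open>h\<close> with the line through \<open>g 1\<close> and \<open>g 2\<close>, unless that
  line lies in \<open>h\<close>.\<close>

definition e_num :: "complex ^ 4 \<Rightarrow> complex ^ 4 \<Rightarrow> (3 \<Rightarrow> complex ^ 4) \<Rightarrow> complex ^ 4" where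
  "e_num h z g = z - (h \<odot> g 2) *s g 1 + (h \<odot> g 1) *s g 2"

lemma poly_eval_e_vec: "poly_eval x (e_vec C c g i $ a) = e_num (x i v* C i) (c i) g $ a"
  by (simp add: e_vec_def e_num_def const_vec_def scalar_product_def poly_eval_add poly_eval_diff
      poly_eval_mult poly_eval_sum poly_eval_back_plane)

lemma nu_poly_eval: "poly_eval x (nu v $ k) = nu (\<chi> a. poly_eval x (v $ a)) $ k"
proof -
  have "\<forall>k. poly_eval x (nu v $ k) = nu (\<chi> a. poly_eval x (v $ a)) $ k"
    unfolding forall_10 by (simp add: nu_def Let_def poly_eval_mult poly_eval_power)
  then show ?thesis by blast
qed

lemma poly_eval_det_Phi:
  fixes C :: "'m::{finite,linorder} \<Rightarrow> complex ^ 4 ^ 3"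
  defines "i \<equiv> \<lambda>\<sigma> k. sorted_list_of_set \<sigma> ! k"
  shows "poly_eval x (det (Phi C c g \<sigma>)) = det (transpose (vector (map nu
    [c (i \<sigma> 0), c (i \<sigma> 1), c (i \<sigma> 2), g 1, g 2, g 3,
     e_num (x (i \<sigma> 0) v* C (i \<sigma> 0)) (c (i \<sigma> 0)) g, e_num (x (i \<sigma> 1) v* C (i \<sigma> 1)) (c (i \<sigma> 1)) g,
     e_num (x (i \<sigma> 2) v* C (i \<sigma> 2)) (c (i \<sigma> 2)) g, e_num (x (i \<sigma> 3) v* C (i \<sigma> 3)) (c (i \<sigma> 3)) g])) :: complex ^ 10 ^ 10)"
proof -
  have ev: "(\<chi> a. poly_eval x (const_vec v $ a)) = v" for v :: "complex ^ 4"
    by (simp add: const_vec_def vec_eq_iff)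
  have map: "map_matrix (poly_eval x) (transpose (vector (map nu [v1, v2, v3, v4, v5, v6, v7, v8, v9, v10]))) =
     (transpose (vector (map (\<lambda>v. nu (\<chi> a. poly_eval x (v $ a))) [v1, v2, v3, v4, v5, v6, v7, v8, v9, v10])) :: complex ^ 10 ^ 10)"
    for v1 v2 v3 v4 v5 v6 v7 v8 v9 v10
  proof -
    have "\<forall>l. \<forall>k. poly_eval x ((vector (map nu [v1, v2, v3, v4, v5, v6, v7, v8, v9, v10]) :: 'm line_poly ^ 10 ^ 10) $ l $ k) =
       (vector (map (\<lambda>v. nu (\<chi> a. poly_eval x (v $ a))) [v1, v2, v3, v4, v5, v6, v7, v8, v9, v10]) :: complex ^ 10 ^ 10) $ l $ k"
      by (subst forall_10) (simp add: nu_poly_eval)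
    then show ?thesis
      by (simp add: vec_eq_iff map_matrix_def transpose_def del: list.map)
  qed
  show ?thesis
    unfolding Phi_def Let_def poly_eval_det map
    by (simp add: ev poly_eval_e_vec i_def)
qed

lemma coefficient_det_neq_0:
  assumes "indep2 z z'" "z = X *s e1 + Y *s e2" "z' = X' *s e1 + Y' *s e2"
  shows "X * Y' - X' * Y \<noteq> 0"
proof
  assume D: "X * Y' - X' * Y = 0"
  have "Y' *s z + (- Y) *s z' = (X * Y' - X' * Y) *s e1"
    unfolding assms(2,3) by (simp add: vec_eq_iff algebra_simps)
  moreover have "X' *s z + (- X) *s z' = - (X * Y' - X' * Y) *s e2"
    unfolding assms(2,3) by (simp add: vec_eq_iff algebra_simps)
  ultimately have "Y' *s z + (- Y) *s z' = 0" "X' *s z + (- X) *s z' = 0"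
    by (simp_all add: D)
  then have "X' = 0" "Y' = 0" using indep2D[OF assms(1)] by blast+
  then have "0 *s z + 1 *s z' = 0" by (simp add: assms(3))
  then show False using indep2D[OF assms(1)] zero_neq_one by metis
qed

text \<open>The geometric meaning of the determinant.  A pair \<open>u, v\<close> is the linear map \<open>\<phi>\<close> from the line
  of the centers to the line \<open>E\<^sup>*\<close> of the points \<open>g\<close> with \<open>\<phi> e1 = u\<close> and \<open>\<phi> e2 = v\<close>, and the
  condition says that \<open>\<phi>\<close> maps each center \<open>c i\<close> into the plane of camera \<open>i\<close>.

  By the preceding results the determinant vanishes if and only if some nonzero bilinear form \<open>B\<close>
  on the product of the two lines vanishes at \<open>(c i, - (h i \<odot> g 2) *s g 1 + (h i \<odot> g 1) *s g 2)\<close> for all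
  \<open>i\<close>, where \<open>h i = x i v* C i\<close>.
  The correspondence \<open>\<phi> x = B (x, g 2) *s g 1 - B (x, g 1) *s g 2\<close> turns the value
  of \<open>B\<close> there into \<open>h i \<odot> \<phi> (c i)\<close>.\<close>

lemma det_Phi_vanishes_iff:
  fixes C :: "'m::{finite,linorder} \<Rightarrow> complex ^ 4 ^ 3"
  assumes card: "card \<sigma> = 4"
    and E: "indep2 e1 e2" and g: "indep2 (g 1) (g 2)"
    and skew: "vec.span {e1, e2} \<inter> vec.span {g 1, g 2} = {0}"
    and g3: "g 3 = s *s g 1 + t *s g 2" "s \<noteq> 0" "t \<noteq> 0"
    and c: "\<And>i. i \<in> \<sigma> \<Longrightarrow> c i = X i *s e1 + Y i *s e2"
    and indep: "\<And>i j. i \<in> \<sigma> \<Longrightarrow> j \<in> \<sigma> \<Longrightarrow> i \<noteq> j \<Longrightarrow> indep2 (c i) (c j)"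
  shows "poly_eval x (det (Phi C c g \<sigma>)) = 0 \<longleftrightarrow>
    (\<exists>u v. u \<in> vec.span {g 1, g 2} \<and> v \<in> vec.span {g 1, g 2} \<and> (u \<noteq> 0 \<or> v \<noteq> 0) \<and>
      (\<forall>i\<in>\<sigma>. (x i v* C i) \<odot> (X i *s u + Y i *s v) = 0))"
proof -
  have "finite \<sigma>" using card card.infinite by fastforce
  define l where "l = sorted_list_of_set \<sigma>"
  have l: "set l = \<sigma>" "distinct l" "length l = 4"
    using \<open>finite \<sigma>\<close> card by (simp_all add: l_def)
  define h where "h i = x i v* C i" for i
  define p r where "p i = - (h i \<odot> g 2)" and "r i = h i \<odot> g 1" for i
  define G where "G = frame e1 e2 (g 1) (g 2)"
  obtain T where T: "T ** G = mat 1" "G ** T = mat 1"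
    unfolding G_def using frame_inverse[OF E g skew] by blast
  have G: "G *v vector [\<alpha>, \<beta>, \<gamma>, \<delta>] = \<alpha> *s e1 + \<beta> *s e2 + \<gamma> *s g 1 + \<delta> *s g 2" for \<alpha> \<beta> \<gamma> \<delta>
    by (simp add: G_def frame_mult)
  have l_in: "l ! k \<in> \<sigma>" if "k < 4" for k using l that by (metis nth_mem)
  have neq: "X (l ! k) * Y (l ! k') - X (l ! k') * Y (l ! k) \<noteq> 0" if "k < 4" "k' < 4" "k \<noteq> k'" for k k'
  proof (rule coefficient_det_neq_0)
    show "indep2 (c (l ! k)) (c (l ! k'))"
      using that l by (intro indep l_in) (auto simp: nth_eq_iff_index_eq)
  qed (use that in \<open>simp_all add: c l_in\<close>)
  define Z where "Z = (\<lambda>k. vector [X (l ! k), Y (l ! k), 0, 0]) ` {0, 1, 2} \<union>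
      {vector [0, 0, 1, 0], vector [0, 0, 0, 1], vector [0, 0, s, t]} \<union>
      (\<lambda>k. vector [X (l ! k), Y (l ! k), p (l ! k), r (l ! k)] :: complex ^ 4) ` {0, 1, 2, 3}"
  have Gc: "G *v vector [X (l ! k), Y (l ! k), 0, 0] = c (l ! k)" if "k < 4" for k
    using c[OF l_in[OF that]] by (simp add: G)
  have Ge: "G *v vector [X (l ! k), Y (l ! k), p (l ! k), r (l ! k)] = e_num (h (l ! k)) (c (l ! k)) g"
    if "k < 4" for k
    using c[OF l_in[OF that]] by (simp add: G e_num_def p_def r_def)
  have Gf: "G *v vector [0, 0, 1, 0] = g 1" "G *v vector [0, 0, 0, 1] = g 2"
    "G *v vector [0, 0, s, t] = g 3"
    by (simp_all add: G g3)
  have "poly_eval x (det (Phi C c g \<sigma>)) = 0 \<longleftrightarrow>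
     (\<exists>q. q \<noteq> 0 \<and> (\<forall>z\<in>{c (l ! 0), c (l ! 1), c (l ! 2), g 1, g 2, g 3,
     e_num (h (l ! 0)) (c (l ! 0)) g, e_num (h (l ! 1)) (c (l ! 1)) g,
     e_num (h (l ! 2)) (c (l ! 2)) g, e_num (h (l ! 3)) (c (l ! 3)) g}. quad q z = 0))"
    unfolding poly_eval_det_Phi det_nu_columns_eq_0_iff h_def l_def ..
  also have "{c (l ! 0), c (l ! 1), c (l ! 2), g 1, g 2, g 3,
     e_num (h (l ! 0)) (c (l ! 0)) g, e_num (h (l ! 1)) (c (l ! 1)) g,
     e_num (h (l ! 2)) (c (l ! 2)) g, e_num (h (l ! 3)) (c (l ! 3)) g} = (\<lambda>z. G *v z) ` Z"
    unfolding Z_def image_Un image_insert image_empty image_image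
    by (simp add: Gc Ge Gf insert_commute insert_is_Un[symmetric])
  also have "(\<exists>q. q \<noteq> 0 \<and> (\<forall>z\<in>(\<lambda>z. G *v z) ` Z. quad q z = 0)) \<longleftrightarrow>
      (\<exists>q. q \<noteq> 0 \<and> (\<forall>z\<in>Z. quad q z = 0))"
    using quadric_in_frame[OF T, of Z] by simp
  also have "\<dots> \<longleftrightarrow> (\<exists>w :: complex ^ 4. w \<noteq> 0 \<and> (\<forall>k\<in>{0, 1, 2, 3}.
        w $ 1 * (X (l ! k) * p (l ! k)) + w $ 2 * (X (l ! k) * r (l ! k))
      + w $ 3 * (Y (l ! k) * p (l ! k)) + w $ 4 * (Y (l ! k) * r (l ! k)) = 0))"
    unfolding Z_def
    by (rule quadric_through_skew_lines[where x = "\<lambda>k. X (l ! k)" and y = "\<lambda>k. Y (l ! k)"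
          and p = "\<lambda>k. p (l ! k)" and r = "\<lambda>k. r (l ! k)"]) (use neq g3 in simp_all)
  also have "\<dots> \<longleftrightarrow> (\<exists>w :: complex ^ 4. w \<noteq> 0 \<and> (\<forall>i\<in>\<sigma>.
        w $ 1 * (X i * p i) + w $ 2 * (X i * r i) + w $ 3 * (Y i * p i) + w $ 4 * (Y i * r i) = 0))"
  proof -
    have "\<sigma> = (\<lambda>k. l ! k) ` {0, 1, 2, 3}"
    proof -
      have "\<sigma> = (\<lambda>k. l ! k) ` {..<4}" using l by (auto simp: set_conv_nth)
      also have "{..<4} = {0, 1, 2, 3 :: nat}" by auto
      finally show ?thesis .
    qed
    then show ?thesis by simp
  qed
  also have "\<dots> \<longleftrightarrow> (\<exists>u v. u \<in> vec.span {g 1, g 2} \<and> v \<in> vec.span {g 1, g 2} \<and> (u \<noteq> 0 \<or> v \<noteq> 0) \<and>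
      (\<forall>i\<in>\<sigma>. h i \<odot> (X i *s u + Y i *s v) = 0))" (is "?w \<longleftrightarrow> ?uv")
  proof
    assume ?w
    then obtain w :: "complex ^ 4" where w: "w \<noteq> 0" "\<And>i. i \<in> \<sigma> \<Longrightarrow>
        w $ 1 * (X i * p i) + w $ 2 * (X i * r i) + w $ 3 * (Y i * p i) + w $ 4 * (Y i * r i) = 0"
      by blast
    define u v where "u = w $ 2 *s g 1 + - w $ 1 *s g 2" and "v = w $ 4 *s g 1 + - w $ 3 *s g 2"
    have "u \<in> vec.span {g 1, g 2}" "v \<in> vec.span {g 1, g 2}"
      unfolding span_pair u_def v_def by blast+
    moreover have "u \<noteq> 0 \<or> v \<noteq> 0"
      using w(1) indep2D[OF g, of "w $ 2" "- w $ 1"] indep2D[OF g, of "w $ 4" "- w $ 3"]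
      by (auto simp: u_def v_def vec_eq_iff[of w] forall_4)
    moreover have "h i \<odot> (X i *s u + Y i *s v) = 0" if "i \<in> \<sigma>" for i
      using w(2)[OF that] by (simp add: u_def v_def p_def r_def dot_simps algebra_simps)
    ultimately show ?uv by blast
  next
    assume ?uv
    then obtain u v where uv: "u \<in> vec.span {g 1, g 2}" "v \<in> vec.span {g 1, g 2}" "u \<noteq> 0 \<or> v \<noteq> 0"
      "\<And>i. i \<in> \<sigma> \<Longrightarrow> h i \<odot> (X i *s u + Y i *s v) = 0" by blast
    obtain \<alpha> \<beta> \<gamma> \<delta> where u: "u = \<alpha> *s g 1 + \<beta> *s g 2" and v: "v = \<gamma> *s g 1 + \<delta> *s g 2"
      using uv(1,2) by (auto simp: span_pair)
    define w :: "complex ^ 4" where "w = vector [- \<beta>, \<alpha>, - \<delta>, \<gamma>]"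
    have "w \<noteq> 0"
    proof
      assume "w = 0"
      then have "w $ 1 = 0" "w $ 2 = 0" "w $ 3 = 0" "w $ 4 = 0" by simp_all
      then show False using uv(3) by (simp add: w_def u v)
    qed
    moreover have "w $ 1 * (X i * p i) + w $ 2 * (X i * r i) + w $ 3 * (Y i * p i) + w $ 4 * (Y i * r i) = 0"
      if "i \<in> \<sigma>" for i
      using uv(4)[OF that] by (simp add: w_def u v p_def r_def dot_simps algebra_simps)
    ultimately show ?w by blast
  qed
  finally show ?thesis unfolding h_def .
qed

lemma frame_decomposition:
  fixes z :: "complex ^ 4"
  assumes "indep2 e1 e2" "indep2 g1 g2" "vec.span {e1, e2} \<inter> vec.span {g1, g2} = {0}"
  shows "\<exists>\<alpha> \<beta> z'. z = \<alpha> *s e1 + \<beta> *s e2 + z' \<and> z' \<in> vec.span {g1, g2}"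
proof -
  obtain T where T: "frame e1 e2 g1 g2 ** T = mat 1" using frame_inverse[OF assms] by blast
  have "z = frame e1 e2 g1 g2 *v (T *v z)" by (simp add: matrix_vector_mul_assoc T)
  also have "\<dots> = (T *v z) $ 1 *s e1 + (T *v z) $ 2 *s e2 + ((T *v z) $ 3 *s g1 + (T *v z) $ 4 *s g2)"
    by (simp add: frame_mult add.assoc)
  finally show ?thesis unfolding span_pair by blast
qed

text \<open>Planes that contain a common line \<open>L\<close> admit such a map \<open>\<phi>\<close>.  If \<open>L\<close> is disjoint from the line of
  \<open>g1, g2\<close>, then \<open>L\<close> is the graph of a linear map \<open>\<phi>\<close>: as \<open>h i\<close> vanishes on \<open>z + \<phi> z\<close>, it takes
  opposite values at \<open>z\<close> and \<open>\<phi> z\<close>, and it vanishes at the center.  The map is nonzero because \<open>L\<close>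
  is not the line of \<open>e1, e2\<close>.  Otherwise \<open>L\<close> contains a nonzero \<open>y\<close> in the span of \<open>g1, g2\<close>, and
  any map with image spanned by \<open>y\<close> works.\<close>

lemma dual_map_of_transversal:
  fixes h :: "'i \<Rightarrow> complex ^ 4"
  assumes E: "indep2 e1 e2" and g: "indep2 g1 g2" and skew: "vec.span {e1, e2} \<inter> vec.span {g1, g2} = {0}"
    and L: "indep2 a b" "\<not> vec.span {e1, e2} = vec.span {a, b}"
    and h: "\<And>i. i \<in> \<sigma> \<Longrightarrow> h i \<odot> a = 0 \<and> h i \<odot> b = 0 \<and> h i \<odot> (X i *s e1 + Y i *s e2) = 0"
  shows "\<exists>u v. u \<in> vec.span {g1, g2} \<and> v \<in> vec.span {g1, g2} \<and> (u \<noteq> 0 \<or> v \<noteq> 0) \<and>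
      (\<forall>i\<in>\<sigma>. h i \<odot> (X i *s u + Y i *s v) = 0)"
proof -
  note dec = frame_decomposition[OF E g skew]
  obtain a1 a2 a' where a: "a = a1 *s e1 + a2 *s e2 + a'" "a' \<in> vec.span {g1, g2}"
    using dec[of a] by blast
  obtain b1 b2 b' where b: "b = b1 *s e1 + b2 *s e2 + b'" "b' \<in> vec.span {g1, g2}"
    using dec[of b] by blast
  define D where "D = a1 * b2 - a2 * b1"
  have ha: "a1 * (h i \<odot> e1) + a2 * (h i \<odot> e2) + h i \<odot> a' = 0"
    and hb: "b1 * (h i \<odot> e1) + b2 * (h i \<odot> e2) + h i \<odot> b' = 0"
    and hc: "X i * (h i \<odot> e1) + Y i * (h i \<odot> e2) = 0" if "i \<in> \<sigma>" for i
    using h[OF that] by (simp_all add: a b dot_simps)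
  show ?thesis
  proof (cases "D = 0")
    case False
    \<comment> \<open>Cramer's rule for the map that sends the \<open>E\<close>-part of \<open>a\<close> to \<open>a'\<close> and that of \<open>b\<close> to \<open>b'\<close>,
       multiplied by \<open>D\<close> to clear denominators.\<close>
    define u v where "u = b2 *s a' - a2 *s b'" and "v = a1 *s b' - b1 *s a'"
    have "u \<in> vec.span {g1, g2}" "v \<in> vec.span {g1, g2}"
      unfolding u_def v_def using a(2) b(2) by (auto intro: vec.span_diff vec.span_scale)
    moreover have "u \<noteq> 0 \<or> v \<noteq> 0"
    proof (rule ccontr)
      assume "\<not> (u \<noteq> 0 \<or> v \<noteq> 0)"
      moreover have "a1 *s u + a2 *s v = D *s a'" "b1 *s u + b2 *s v = D *s b'"
        by (simp_all add: u_def v_def D_def vec_eq_iff algebra_simps)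
      ultimately have "a' = 0" "b' = 0" using False by auto
      then have "a \<in> vec.span {e1, e2}" "b \<in> vec.span {e1, e2}" by (auto simp: a b span_pair)
      then show False
        using is_line_eq_span_pair[of "vec.span {e1, e2}" a b] L E is_line_span_pair by blast
    qed
    moreover have "h i \<odot> (X i *s u + Y i *s v) = 0" if "i \<in> \<sigma>" for i
    proof -
      have "h i \<odot> u = - D * (h i \<odot> e1)" "h i \<odot> v = - D * (h i \<odot> e2)"
        using ha[OF that] hb[OF that] unfolding u_def v_def D_def dot_simps by algebra+
      then have "h i \<odot> (X i *s u + Y i *s v) = - D * (X i * (h i \<odot> e1) + Y i * (h i \<odot> e2))"
        by (simp add: dot_simps algebra_simps)
      then show ?thesis using hc[OF that] by simp
    qed
    ultimately show ?thesis by blast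
  next
    case True
    have "\<exists>\<alpha> \<beta>. (\<alpha> \<noteq> 0 \<or> \<beta> \<noteq> 0) \<and> \<alpha> * a1 + \<beta> * b1 = 0 \<and> \<alpha> * a2 + \<beta> * b2 = 0"
    proof (cases "a1 = 0 \<and> b1 = 0 \<and> a2 = 0 \<and> b2 = 0")
      case True
      then show ?thesis by (intro exI[of _ 1]) auto
    next
      case False
      show ?thesis
      proof (cases "a1 = 0 \<and> b1 = 0")
        case True
        then show ?thesis using False by (intro exI[of _ b2] exI[of _ "- a2"]) auto
      next
        case f: False
        then show ?thesis using \<open>D = 0\<close>
          by (intro exI[of _ b1] exI[of _ "- a1"]) (auto simp: D_def algebra_simps)
      qed
    qed
    then obtain \<alpha> \<beta> where ab: "\<alpha> \<noteq> 0 \<or> \<beta> \<noteq> 0" "\<alpha> * a1 + \<beta> * b1 = 0" "\<alpha> * a2 + \<beta> * b2 = 0" by blast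
    define u where "u = \<alpha> *s a + \<beta> *s b"
    have "u = (\<alpha> * a1 + \<beta> * b1) *s e1 + (\<alpha> * a2 + \<beta> * b2) *s e2 + (\<alpha> *s a' + \<beta> *s b')"
      by (simp add: u_def a b vec_eq_iff algebra_simps)
    then have "u \<in> vec.span {g1, g2}"
      using a(2) b(2) by (simp add: ab vec.span_add vec.span_scale)
    moreover have "u \<noteq> 0" using indep2D[OF L(1)] ab(1) by (auto simp: u_def)
    moreover have "h i \<odot> (X i *s u + Y i *s 0) = 0" if "i \<in> \<sigma>" for i
      using h[OF that] by (simp add: u_def dot_simps)
    ultimately show ?thesis using vec.span_zero by blast
  qed
qed

section \<open>Cameras\<close>

lemma cross_prod_nth [simp]:
  "cross_prod p q $ 1 = p $ 2 * q $ 3 - p $ 3 * q $ 2"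
  "cross_prod p q $ 2 = p $ 3 * q $ 1 - p $ 1 * q $ 3"
  "cross_prod p q $ 3 = p $ 1 * q $ 2 - p $ 2 * q $ 1"
  by (simp_all add: cross_prod_def)

lemma cross_prod_eq_0_iff: "cross_prod p q = 0 \<longleftrightarrow> \<not> indep2 p q"
proof
  assume z: "cross_prod p q = 0"
  have *: "q $ k *s p + (- p $ k) *s q = 0" for k
    using exhaust_3[of k] z by (auto simp: vec_eq_iff forall_3 algebra_simps)
  show "\<not> indep2 p q"
  proof
    assume i: "indep2 p q"
    have "p = 0" using indep2D[OF i *] by (simp add: vec_eq_iff)
    then show False using indep2D[OF i, of 1 0] by simp
  qed
next
  assume "\<not> indep2 p q"
  then obtain \<alpha> \<beta> where ab: "\<alpha> *s p + \<beta> *s q = 0" "\<alpha> \<noteq> 0 \<or> \<beta> \<noteq> 0"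
    by (auto simp: indep2_def)
  then have e: "\<alpha> * p $ k + \<beta> * q $ k = 0" for k
    by (metis vector_add_component vector_smult_component zero_index)
  have "\<alpha> *s cross_prod p q = 0" "\<beta> *s cross_prod p q = 0"
    using e[of 1] e[of 2] e[of 3] by (simp_all add: vec_eq_iff forall_3) algebra+
  then show "cross_prod p q = 0" using ab(2) by auto
qed

lemma dot_cross_prod:
  "x \<odot> p = 0 \<Longrightarrow> x \<odot> q = 0 \<Longrightarrow> cross_prod (cross_prod p q) x = 0"
  unfolding scalar_product_def by (simp add: sum_3 vec_eq_iff forall_3) algebra

lemma cross_prod_dot: "cross_prod p q \<odot> p = 0" "cross_prod p q \<odot> q = 0"
  by (simp_all add: scalar_product_def sum_3 algebra_simps)

lemma cross_prod_eq_multiple: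
  assumes "x \<odot> p = 0" "x \<odot> q = 0" "x \<noteq> 0" "indep2 p q"
  obtains \<mu> where "\<mu> \<noteq> 0" "cross_prod p q = \<mu> *s x"
proof -
  let ?w = "cross_prod p q"
  have "\<not> indep2 ?w x" using dot_cross_prod[OF assms(1,2)] by (simp add: cross_prod_eq_0_iff)
  then obtain \<alpha> \<beta> where ab: "\<alpha> *s ?w + \<beta> *s x = 0" "\<alpha> \<noteq> 0 \<or> \<beta> \<noteq> 0"
    by (auto simp: indep2_def)
  have w: "?w \<noteq> 0" using assms(4) by (simp add: cross_prod_eq_0_iff)
  have "\<alpha> \<noteq> 0" using ab assms(3) by auto
  have "\<alpha> *s ?w = - \<beta> *s x" using ab(1) by (simp add: add_eq_0_iff2)
  then have "inverse \<alpha> *s (\<alpha> *s ?w) = inverse \<alpha> *s (- \<beta> *s x)" by (rule arg_cong)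
  then have eq: "?w = (- \<beta> / \<alpha>) *s x" using \<open>\<alpha> \<noteq> 0\<close> by (simp add: vec.scale_scale field_simps)
  moreover have "- \<beta> / \<alpha> \<noteq> 0" using w eq by auto
  ultimately show ?thesis using that by blast
qed

lemma cross_prod_change_basis:
  "cross_prod (\<alpha> *s p + \<beta> *s q) (\<gamma> *s p + \<delta> *s q) = (\<alpha> * \<delta> - \<beta> * \<gamma>) *s cross_prod p q"
  by (simp add: vec_eq_iff forall_3 algebra_simps)

lemma cross_prod_scale: "cross_prod (t *s p) q = t *s cross_prod p q"
  by (simp add: vec_eq_iff forall_3 algebra_simps)

lemma tendsto_cross_prod:
  assumes "(p \<longlongrightarrow> p0) F" "(q \<longlongrightarrow> q0) F"
  shows "((\<lambda>t. cross_prod (p t) (q t)) \<longlongrightarrow> cross_prod p0 q0) F"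
proof (rule vec_tendstoI)
  have "\<forall>k. ((\<lambda>t. cross_prod (p t) (q t) $ k) \<longlongrightarrow> cross_prod p0 q0 $ k) F"
    unfolding forall_3 cross_prod_nth by (intro conjI tendsto_intros assms)
  then show "((\<lambda>t. cross_prod (p t) (q t) $ k) \<longlongrightarrow> cross_prod p0 q0 $ k) F" for k ..
qed

lemma tendsto_smult:
  assumes "(g \<longlongrightarrow> s) F" "(p \<longlongrightarrow> p0) F"
  shows "((\<lambda>t. g t *s (p t :: complex ^ 'n)) \<longlongrightarrow> s *s p0) F"
  by (rule vec_tendstoI) (auto intro!: tendsto_intros assms)

lemma tendsto_matrix_vector:
  fixes A :: "complex ^ 'n ^ 'm"
  assumes "(p \<longlongrightarrow> p0) F"
  shows "((\<lambda>t. A *v p t) \<longlongrightarrow> A *v p0) F"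
  by (rule vec_tendstoI) (auto intro!: tendsto_intros assms simp: matrix_vector_mult_def)

locale camera =
  fixes A :: "complex ^ 4 ^ 3" and c :: "complex ^ 4"
  assumes rank: "rank A = 3" and center: "proj_point c = center A"
begin

lemma kernel_iff: "A *v y = 0 \<longleftrightarrow> (\<exists>t. y = t *s c)"
proof -
  have "A *v y = 0 \<longleftrightarrow> y \<in> proj_point c" by (simp add: center center_def)
  then show ?thesis unfolding proj_point_def vec.span_singleton by blast
qed

lemma center_mult [simp]: "A *v c = 0"
  using kernel_iff[of c] by (metis vector_smult_lid)

lemma center_neq_0: "c \<noteq> 0"
proof -
  have "vec.dim (rows A) < CARD(4)" using rank by (simp add: row_rank_def_gen)
  then obtain z where z: "z \<noteq> 0" "\<And>y. y \<in> rows A \<Longrightarrow> y \<odot> z = 0"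
    by (rule dim_less_imp_annihilator) blast
  have "A $ i \<in> rows A" for i by (auto simp: rows_def row_def)
  then have "A *v z = 0"
    using z(2) by (simp add: vec_eq_iff matrix_vector_mult_def scalar_product_def)
  with z(1) show ?thesis by (auto simp: kernel_iff)
qed

lemma rows_independent:
  assumes "x v* A = 0"
  shows "x = 0"
proof (rule ccontr)
  assume "x \<noteq> 0"
  then obtain i where i: "x $ i \<noteq> 0" by (auto simp: vec_eq_iff)
  let ?R = "(\<lambda>j. A $ j) ` (UNIV - {i})"
  have "(\<Sum>j\<in>UNIV. x $ j *s A $ j) = 0"
    using assms by (simp add: vec_eq_iff vector_matrix_mult_def mult.commute)
  then have "x $ i *s A $ i + (\<Sum>j\<in>UNIV - {i}. x $ j *s A $ j) = 0"
    by (subst (asm) sum.remove[of UNIV i]) auto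
  then have "x $ i *s A $ i = - (\<Sum>j\<in>UNIV - {i}. x $ j *s A $ j)" by (simp add: add_eq_0_iff2)
  also have "\<dots> \<in> vec.span ?R"
    by (intro vec.span_neg vec.span_sum vec.span_scale vec.span_base) auto
  finally have Ai: "A $ i \<in> vec.span ?R" using i by (simp add: span_scale_iff)
  have "rows A \<subseteq> vec.span ?R"
  proof
    fix y assume "y \<in> rows A"
    then obtain j where "y = A $ j" by (auto simp: rows_def row_def)
    then show "y \<in> vec.span ?R" using Ai by (cases "j = i") (auto intro: vec.span_base)
  qed
  then have "vec.dim (rows A) \<le> vec.dim ?R" by (rule vec.dim_subset[THEN order_trans]) simp
  also have "\<dots> \<le> card ?R" by (rule vec.dim_le_card') simp
  also have "\<dots> \<le> card (UNIV - {i})" by (rule card_image_le) simp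
  finally show False using rank by (simp add: row_rank_def_gen)
qed

lemma image_indep2:
  assumes "indep2 p q" "\<And>\<alpha> \<beta>. c \<noteq> \<alpha> *s p + \<beta> *s q"
  shows "indep2 (A *v p) (A *v q)"
  unfolding indep2_def
proof (intro allI impI)
  fix \<alpha> \<beta> assume "\<alpha> *s (A *v p) + \<beta> *s (A *v q) = 0"
  then have "A *v (\<alpha> *s p + \<beta> *s q) = 0" by (simp add: vec.add vec.scale)
  then obtain t where t: "\<alpha> *s p + \<beta> *s q = t *s c" unfolding kernel_iff by blast
  have "t = 0"
  proof (rule ccontr)
    assume "t \<noteq> 0"
    have "c = inverse t *s (t *s c)" using \<open>t \<noteq> 0\<close> by (simp add: vec.scale_scale)
    also have "\<dots> = (\<alpha> / t) *s p + (\<beta> / t) *s q"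
      unfolding t[symmetric] by (simp add: vec_eq_iff field_simps)
    finally show False using assms(2) by blast
  qed
  with t indep2D[OF assms(1)] show "\<alpha> = 0 \<and> \<beta> = 0" by simp
qed

text \<open>If \<open>p, q\<close> are dependent, or if a nontrivial combination of them is in the kernel of \<open>A\<close>, then
  \<open>A *v p\<close> and \<open>A *v q\<close> are dependent.\<close>

lemma line_avoids_center:
  assumes "cross_prod (A *v p) (A *v q) \<noteq> 0"
  shows "indep2 p q" "\<not> center A \<subseteq> vec.span {p, q}"
proof -
  have i: "indep2 (A *v p) (A *v q)" using assms by (simp add: cross_prod_eq_0_iff)
  have z: "\<alpha> = 0 \<and> \<beta> = 0" if "A *v (\<alpha> *s p + \<beta> *s q) = 0" for \<alpha> \<beta>
    using that indep2D[OF i] by (simp add: vec.add vec.scale)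
  show "indep2 p q"
    unfolding indep2_def by (intro allI impI z) simp
  show "\<not> center A \<subseteq> vec.span {p, q}"
  proof
    assume "center A \<subseteq> vec.span {p, q}"
    moreover have "c \<in> center A" by (simp add: center_def)
    ultimately have "c \<in> vec.span {p, q}" by blast
    then obtain \<alpha> \<beta> where c: "c = \<alpha> *s p + \<beta> *s q" by (auto simp: span_pair)
    then have "c = 0" using z[of \<alpha> \<beta>] center_mult by simp
    then show False using center_neq_0 by blast
  qed
qed

lemma center_subset_iff: "vec.subspace S \<Longrightarrow> center A \<subseteq> S \<longleftrightarrow> c \<in> S"
proof
  assume "center A \<subseteq> S"
  moreover have "c \<in> center A" by (simp add: center_def)
  ultimately show "c \<in> S" by blast
next
  assume S: "vec.subspace S" and c: "c \<in> S"
  then show "center A \<subseteq> S"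
    unfolding center[symmetric] proj_point_def by (intro vec.span_minimal) auto
qed

end

section \<open>Limits of lines\<close>

text \<open>Polynomials are continuous, so limits of points of the image in the Euclidean sense lie in its
  Zariski closure.  The images of a moving line may degenerate to zero vectors at \<open>t = 0\<close>; after
  division by a power of \<open>t\<close> they have limits that are valid representatives.\<close>

lemma limit_in_line_multiview_variety:
  fixes C :: "'m::finite \<Rightarrow> complex ^ 4 ^ 3" and a b :: "complex \<Rightarrow> complex ^ 4"
  assumes cam: "\<And>i. camera (C i) (c i)"
    and x: "\<And>i. x i \<noteq> 0"
    and z: "\<And>i t. cross_prod (C i *v a t) (C i *v b t) = (\<mu> i * t ^ k i) *s z i t"
    and \<mu>: "\<And>i. \<mu> i \<noteq> 0"
    and lim: "\<And>i. (z i \<longlongrightarrow> x i) (at 0)"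
  shows "(\<lambda>i. proj_point (x i)) \<in> line_multiview_variety C"
  unfolding line_multiview_variety_def zariski_closure_def
proof (intro InterI, clarify)
  fix Z assume "zariski_closed Z" and sub: "{\<lambda>i. proj_point (cross_prod (C i *v a) (C i *v b)) | a b.
        is_line (vec.span {a, b}) \<and> (\<forall>i. \<not> center (C i) \<subseteq> vec.span {a, b})} \<subseteq> Z"
  then obtain S where Z: "Z = zero_locus S" by (auto simp: zariski_closed_def)
  have "poly_eval y p = 0" if p: "p \<in> S" and y: "\<And>i. proj_point (y i) = proj_point (x i)" for y p
  proof -
    have "\<exists>s. s \<noteq> 0 \<and> y i = s *s x i" for i
      using proj_point_eq_imp_multiple[OF y x] by metis
    then obtain s where s: "\<And>i. s i \<noteq> 0" "\<And>i. y i = s i *s x i" by metis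
    have ev: "\<forall>\<^sub>F t in at 0. t \<noteq> 0 \<and> (\<forall>i. z i t \<noteq> 0)"
      by (intro eventually_conj eventually_neq_at_within eventually_all_finite
          tendsto_imp_eventually_ne[OF lim x])
    have "\<forall>\<^sub>F t in at 0. poly_eval (\<lambda>i. s i *s z i t) p = 0"
      using ev
    proof eventually_elim
      case (elim t)
      have nz: "cross_prod (C i *v a t) (C i *v b t) \<noteq> 0" for i
        using elim \<mu> by (simp add: z)
      have "(\<lambda>i. proj_point (cross_prod (C i *v a t) (C i *v b t))) \<in> Z"
        using camera.line_avoids_center[OF cam nz] is_line_span_pair sub by blast
      moreover have "proj_point (s i *s z i t) = proj_point (cross_prod (C i *v a t) (C i *v b t))" for i
        using s(1) \<mu> elim by (simp add: z proj_point_scale)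
      ultimately show ?case
        using p by (auto simp: Z zero_locus_eq)
    qed
    then have lim_0: "((\<lambda>t. poly_eval (\<lambda>i. s i *s z i t) p) \<longlongrightarrow> 0) (at 0)"
      by (rule tendsto_eventually)
    have "((\<lambda>t. poly_eval (\<lambda>i. s i *s z i t) p) \<longlongrightarrow> poly_eval y p) (at 0)"
      by (intro tendsto_poly_eval) (simp add: s(2) tendsto_smult lim)
    then show ?thesis
      using lim_0 by (rule tendsto_unique[OF at_neq_bot])
  qed
  then show "(\<lambda>i. proj_point (x i)) \<in> Z"
    unfolding Z zero_locus_eq multiproj_def proj_space_def using x by auto
qed

text \<open>The limit of the rescaled images is orthogonal to the two independent vectors \<open>A *v p0\<close> and
  \<open>A *v d0\<close>, and so is \<open>x\<close>; hence they agree up to a nonzero factor.\<close>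

lemma rescaled_image_of_moving_line:
  assumes x: "x \<noteq> 0" "x \<odot> (A *v p0) = 0" "x \<odot> (A *v d0) = 0"
    and "(p \<longlongrightarrow> p0) (at 0)" "(d \<longlongrightarrow> d0) (at 0)"
    and ind: "indep2 (A *v p0) (A *v d0)"
    and eq: "\<And>t. cross_prod (A *v a t) (A *v b t) = t ^ k *s cross_prod (A *v p t) (A *v d t)"
  shows "\<exists>\<mu> k z. \<mu> \<noteq> 0 \<and> (\<forall>t. cross_prod (A *v a t) (A *v b t) = (\<mu> * t ^ k) *s z t) \<and>
    (z \<longlongrightarrow> x) (at 0)"
proof -
  obtain \<mu> where \<mu>: "\<mu> \<noteq> 0" "cross_prod (A *v p0) (A *v d0) = \<mu> *s x"
    using cross_prod_eq_multiple[OF x(2,3,1) ind] by blast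
  let ?z = "\<lambda>t. inverse \<mu> *s cross_prod (A *v p t) (A *v d t)"
  have "(?z \<longlongrightarrow> inverse \<mu> *s (\<mu> *s x)) (at 0)"
    unfolding \<mu>(2)[symmetric]
    by (intro tendsto_smult tendsto_const tendsto_cross_prod tendsto_matrix_vector assms)
  then have "(?z \<longlongrightarrow> x) (at 0)" using \<mu>(1) by (simp add: vec.scale_scale)
  moreover have "cross_prod (A *v a t) (A *v b t) = (\<mu> * t ^ k) *s ?z t" for t
    using \<mu>(1) by (simp add: eq vec.scale_scale field_simps)
  ultimately show ?thesis using \<mu>(1) by (intro exI[of _ \<mu>] exI[of _ k] exI[of _ ?z]) auto
qed

text \<open>The line through \<open>a\<close> and \<open>b\<close> is moved along \<open>a' t\<close> and \<open>b' t\<close>, and \<open>X\<close>, \<open>Y\<close> are the coordinates of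
  the center if it lies on the initial line.  In that case the moving line contains the point
  \<open>c + t *s \<phi> + t\<^sup>2 *s \<psi>\<close> with \<open>\<phi> = X *s u + Y *s v\<close> and \<open>\<psi> = X *s u' + Y *s v'\<close>.  The camera does
  not see \<open>c\<close>, so the image of the line vanishes to first order if \<open>\<phi>\<close> is nonzero and to second order
  otherwise, and its leading term represents the image of the plane spanned by the initial line and
  \<open>\<phi>\<close> or \<open>\<psi>\<close>, respectively.  By assumption this plane is \<open>h\<close>.\<close>

lemma image_of_moving_line:
  fixes A :: "complex ^ 4 ^ 3" and x :: "complex ^ 3" and a b u v u' v' :: "complex ^ 4" and X Y :: complex
  defines "h \<equiv> x v* A"
  assumes cam: "camera A c" and ab: "indep2 a b" "h \<odot> a = 0" "h \<odot> b = 0" and x: "x \<noteq> 0"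
    and c: "c \<in> vec.span {a, b} \<Longrightarrow> c = X *s a + Y *s b"
    and \<phi>: "c \<in> vec.span {a, b} \<Longrightarrow> h \<odot> (X *s u + Y *s v) = 0"
    and skew: "c \<in> vec.span {a, b} \<Longrightarrow> X *s u + Y *s v \<noteq> 0 \<Longrightarrow> X *s u + Y *s v \<notin> vec.span {a, b}"
    and \<psi>: "c \<in> vec.span {a, b} \<Longrightarrow> X *s u + Y *s v = 0 \<Longrightarrow>
       X *s u' + Y *s v' \<notin> vec.span {a, b} \<and> h \<odot> (X *s u' + Y *s v') = 0"
  defines "a' \<equiv> \<lambda>t. a + t *s u + t\<^sup>2 *s u'" and "b' \<equiv> \<lambda>t. b + t *s v + t\<^sup>2 *s v'"
  shows "\<exists>\<mu> k z. \<mu> \<noteq> 0 \<and> (\<forall>t. cross_prod (A *v a' t) (A *v b' t) = (\<mu> * t ^ k) *s z t) \<and>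
    (z \<longlongrightarrow> x) (at 0)"
proof -
  interpret camera A c by (rule cam)
  have h: "h \<odot> y = x \<odot> (A *v y)" for y by (simp add: h_def dot_vector_matrix)
  have lim: "((\<lambda>t. y + t *s w + t\<^sup>2 *s w') \<longlongrightarrow> y) (at 0)" for y w w' :: "complex ^ 4"
  proof -
    have "((\<lambda>t. y + t *s w + t\<^sup>2 *s w') \<longlongrightarrow> y + 0 *s w + 0\<^sup>2 *s w') (at 0)"
      by (intro tendsto_add tendsto_smult tendsto_const tendsto_ident_at tendsto_power)
    then show ?thesis by simp
  qed
  show ?thesis
  proof (cases "c \<in> vec.span {a, b}")
    case False
    have "indep2 (A *v a) (A *v b)"
      by (rule image_indep2[OF ab(1)]) (use False in \<open>auto simp: span_pair\<close>)
    then show ?thesis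
      using ab(2,3) x by (intro rescaled_image_of_moving_line[where k = 0 and p = a' and d = b'])
        (auto simp: h a'_def b'_def lim)
  next
    case True
    note c = c[OF True]
    have "X \<noteq> 0 \<or> Y \<noteq> 0" using c center_neq_0 by auto
    then obtain \<gamma> \<delta> where gd: "X * \<delta> - Y * \<gamma> = 1"
    proof
      assume "X \<noteq> 0"
      then show thesis by (intro that[of "1 / X" 0]) simp
    next
      assume "Y \<noteq> 0"
      then show thesis by (intro that[of 0 "- 1 / Y"]) simp
    qed
    \<comment> \<open>A second point of the line, chosen such that the change of basis from \<open>a, b\<close> to \<open>c, d0\<close> has
       determinant one.\<close>
    define d0 where "d0 = \<gamma> *s a + \<delta> *s b"
    define d where "d t = \<gamma> *s a' t + \<delta> *s b' t" for t
    have d_lim: "(d \<longlongrightarrow> d0) (at 0)"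
      unfolding d_def d0_def a'_def b'_def
      by (intro tendsto_add[of _ "\<gamma> *s a"] tendsto_smult tendsto_const lim)
    have d0: "h \<odot> d0 = 0" using ab by (simp add: d0_def dot_simps)
    let ?f = "X *s u + Y *s v" and ?g = "X *s u' + Y *s v'"
    have cross: "cross_prod (A *v a' t) (A *v b' t) = cross_prod (A *v (t *s ?f + t\<^sup>2 *s ?g)) (A *v d t)" for t
    proof -
      have "X *s a' t + Y *s b' t = c + (t *s ?f + t\<^sup>2 *s ?g)"
        unfolding c a'_def b'_def by (simp add: vec_eq_iff algebra_simps)
      then have "A *v (t *s ?f + t\<^sup>2 *s ?g) = A *v (X *s a' t + Y *s b' t)"
        by (simp add: vec.add)
      then have "cross_prod (A *v (t *s ?f + t\<^sup>2 *s ?g)) (A *v d t) =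
          cross_prod (X *s (A *v a' t) + Y *s (A *v b' t)) (\<gamma> *s (A *v a' t) + \<delta> *s (A *v b' t))"
        by (simp add: d_def vec.add vec.scale)
      then show ?thesis by (simp add: cross_prod_change_basis gd)
    qed
    have ind: "indep2 (A *v y) (A *v d0)" if y: "y \<notin> vec.span {a, b}" for y
    proof (rule image_indep2)
      have d0_span: "d0 \<in> vec.span {a, b}" unfolding d0_def span_pair by blast
      have y0: "\<alpha> = 0" if "\<alpha> *s y + \<beta> *s d0 \<in> vec.span {a, b}" for \<alpha> \<beta>
      proof -
        have "(\<alpha> *s y + \<beta> *s d0) - \<beta> *s d0 \<in> vec.span {a, b}"
          using that d0_span by (intro vec.span_diff vec.span_scale)
        then show ?thesis using y by (simp add: span_scale_iff)
      qed
      have d0_nz: "d0 \<noteq> 0" using indep2D[OF ab(1), of \<gamma> \<delta>] gd by (auto simp: d0_def)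
      show "indep2 y d0"
        unfolding indep2_def
      proof (intro allI impI)
        fix \<alpha> \<beta> assume eq: "\<alpha> *s y + \<beta> *s d0 = 0"
        then have "\<alpha> = 0" using y0[of \<alpha> \<beta>] vec.span_zero by metis
        then show "\<alpha> = 0 \<and> \<beta> = 0" using eq d0_nz by simp
      qed
      show "c \<noteq> \<alpha> *s y + \<beta> *s d0" for \<alpha> \<beta>
      proof
        assume eq: "c = \<alpha> *s y + \<beta> *s d0"
        then have "\<alpha> = 0" using y0 True by metis
        then have "(X - \<beta> * \<gamma>) *s a + (Y - \<beta> * \<delta>) *s b = 0"
          using eq unfolding c d0_def by (simp add: vec_eq_iff algebra_simps)
        then have "X - \<beta> * \<gamma> = 0 \<and> Y - \<beta> * \<delta> = 0" by (rule indep2D[OF ab(1)])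
        then show False using gd by (simp add: algebra_simps)
      qed
    qed
    show ?thesis
    proof (cases "?f = 0")
      case False
      have "((\<lambda>t. ?f + t *s ?g) \<longlongrightarrow> ?f + 0 *s ?g) (at 0)"
        by (intro tendsto_add tendsto_smult tendsto_const tendsto_ident_at)
      then have p_lim: "((\<lambda>t. ?f + t *s ?g) \<longlongrightarrow> ?f) (at 0)" by simp
      have "t *s ?f + t\<^sup>2 *s ?g = t *s (?f + t *s ?g)" for t
        by (simp add: vec_eq_iff algebra_simps power2_eq_square)
      then have "cross_prod (A *v a' t) (A *v b' t) = t ^ 1 *s cross_prod (A *v (?f + t *s ?g)) (A *v d t)" for t
        by (simp only: cross vec.scale cross_prod_scale power_one_right)
      then show ?thesis
        using \<phi>[OF True] d0 unfolding h
        by (intro rescaled_image_of_moving_line[OF x _ _ p_lim d_lim ind[OF skew[OF True False]]])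
    next
      case f: True
      have "cross_prod (A *v a' t) (A *v b' t) = t\<^sup>2 *s cross_prod (A *v ?g) (A *v d t)" for t
        by (simp only: cross f vec.scale cross_prod_scale vector_smult_rzero add_0)
      then show ?thesis
        using \<psi>[OF True f] d0 unfolding h
        by (intro rescaled_image_of_moving_line[OF x _ _ tendsto_const d_lim ind]) auto
    qed
  qed
qed

text \<open>A nonzero map kills at most one of the pairwise independent centers.  For this one the term of
  second order can be prescribed freely.\<close>

lemma second_order_term:
  fixes h :: "'i \<Rightarrow> complex ^ 4"
  assumes uv: "u \<noteq> 0 \<or> v \<noteq> 0"
    and XY: "\<And>i j. i \<in> \<sigma> \<Longrightarrow> j \<in> \<sigma> \<Longrightarrow> i \<noteq> j \<Longrightarrow> X i * Y j - X j * Y i \<noteq> 0"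
    and XY0: "\<And>i. i \<in> \<sigma> \<Longrightarrow> X i \<noteq> 0 \<or> Y i \<noteq> (0 :: complex)"
    and h: "\<And>i. i \<in> \<sigma> \<Longrightarrow> \<exists>w. w \<notin> S \<and> h i \<odot> w = 0"
  obtains u' v' where "\<And>i. i \<in> \<sigma> \<Longrightarrow> X i *s u + Y i *s v = 0 \<Longrightarrow>
     X i *s u' + Y i *s v' \<notin> S \<and> h i \<odot> (X i *s u' + Y i *s v') = 0"
proof (cases "\<exists>j\<in>\<sigma>. X j *s u + Y j *s v = 0")
  case False
  then show ?thesis using that by blast
next
  case True
  then obtain j where j: "j \<in> \<sigma>" "X j *s u + Y j *s v = 0" by blast
  obtain w where w: "w \<notin> S" "h j \<odot> w = 0" using h[OF j(1)] by blast
  obtain \<gamma> \<delta> where gd: "X j * \<gamma> + Y j * \<delta> = 1"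
  proof (cases "X j = 0")
    case True
    then show thesis using XY0[OF j(1)] by (intro that[of 0 "1 / Y j"]) simp
  next
    case False
    then show thesis by (intro that[of "1 / X j" 0]) simp
  qed
  show ?thesis
  proof (rule that)
    fix i assume i: "i \<in> \<sigma>" "X i *s u + Y i *s v = 0"
    have "i = j"
    proof (rule ccontr)
      assume "i \<noteq> j"
      have "(X i * Y j - X j * Y i) *s u = Y j *s (X i *s u + Y i *s v) - Y i *s (X j *s u + Y j *s v)"
        "(X i * Y j - X j * Y i) *s v = X i *s (X j *s u + Y j *s v) - X j *s (X i *s u + Y i *s v)"
        by (simp_all add: vec_eq_iff algebra_simps)
      then show False using XY[OF i(1) j(1) \<open>i \<noteq> j\<close>] uv i(2) j(2) by simp
    qed
    have "X j *s (\<gamma> *s w) + Y j *s (\<delta> *s w) = (X j * \<gamma> + Y j * \<delta>) *s w"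
      by (simp add: vec_eq_iff algebra_simps)
    then show "X i *s (\<gamma> *s w) + Y i *s (\<delta> *s w) \<notin> S \<and> h i \<odot> (X i *s (\<gamma> *s w) + Y i *s (\<delta> *s w)) = 0"
      using w by (simp add: gd \<open>i = j\<close>)
  qed
qed

text \<open>For fixed \<open>w1, w2\<close> the unknown pair \<open>u, v\<close> has four coordinates, and every \<open>i\<close> contributes one linear
  equation \<open>q i\<close>.  If the equations had only the zero solution, then four of them would already be
  independent.  Fewer than four equations always have a nonzero solution, by dimension.\<close>

lemma common_solution_if_four_by_four:
  fixes h :: "'i \<Rightarrow> complex ^ 4"
  assumes w: "indep2 w1 w2"
    and four: "\<And>\<tau>. \<tau> \<subseteq> \<sigma> \<Longrightarrow> card \<tau> = 4 \<Longrightarrow>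
      \<exists>u v. u \<in> vec.span {w1, w2} \<and> v \<in> vec.span {w1, w2} \<and> (u \<noteq> 0 \<or> v \<noteq> 0) \<and>
        (\<forall>i\<in>\<tau>. h i \<odot> (X i *s u + Y i *s v) = 0)"
  shows "\<exists>u v. u \<in> vec.span {w1, w2} \<and> v \<in> vec.span {w1, w2} \<and> (u \<noteq> 0 \<or> v \<noteq> 0) \<and>
        (\<forall>i\<in>\<sigma>. h i \<odot> (X i *s u + Y i *s v) = 0)"
proof -
  define q :: "'i \<Rightarrow> complex ^ 4" where
    "q i = vector [X i * (h i \<odot> w1), X i * (h i \<odot> w2), Y i * (h i \<odot> w1), Y i * (h i \<odot> w2)]" for i
  have q: "h i \<odot> (X i *s (z $ 1 *s w1 + z $ 2 *s w2) + Y i *s (z $ 3 *s w1 + z $ 4 *s w2)) = q i \<odot> z" for i z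
    by (simp add: q_def dot_simps scalar_product_def[of _ z] sum_4 algebra_simps)
  have "vec.dim (q ` \<sigma>) < CARD(4)"
  proof (rule ccontr)
    assume d: "\<not> vec.dim (q ` \<sigma>) < CARD(4)"
    obtain B where B: "B \<subseteq> q ` \<sigma>" "vec.independent B" "card B = vec.dim (q ` \<sigma>)"
      by (rule vec.basis_exists[of "q ` \<sigma>"])
    have U: "vec.dim (UNIV :: (complex ^ 4) set) = 4" by (subst vec_dim_card) simp
    have "vec.dim (q ` \<sigma>) = 4"
      using d vec.dim_subset[of "q ` \<sigma>" UNIV] unfolding U by simp
    then have cB: "card B = 4" using B by simp
    have "UNIV \<subseteq> vec.span B"
      by (rule vec.card_ge_dim_independent) (use B(2) cB U in auto)
    obtain \<tau> where \<tau>: "\<tau> \<subseteq> \<sigma>" "inj_on q \<tau>" "B = q ` \<tau>"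
      using B(1) by (auto simp: subset_image_inj)
    then have "card \<tau> = 4" using cB card_image by fastforce
    from four[OF \<tau>(1) this] obtain u v where uv: "u \<in> vec.span {w1, w2}" "v \<in> vec.span {w1, w2}"
      "u \<noteq> 0 \<or> v \<noteq> 0" "\<And>i. i \<in> \<tau> \<Longrightarrow> h i \<odot> (X i *s u + Y i *s v) = 0" by blast
    obtain \<alpha> \<beta> \<gamma> \<delta> where u: "u = \<alpha> *s w1 + \<beta> *s w2" and v: "v = \<gamma> *s w1 + \<delta> *s w2"
      using uv(1,2) by (auto simp: span_pair)
    define z :: "complex ^ 4" where "z = vector [\<alpha>, \<beta>, \<gamma>, \<delta>]"
    have "q i \<odot> z = 0" if "i \<in> \<tau>" for i
      using uv(4)[OF that] q[of i z] by (simp add: z_def u v)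
    then have "B \<subseteq> {y. y \<odot> z = 0}" using \<tau>(3) by blast
    moreover have "vec.subspace {y. y \<odot> z = 0}" by (auto simp: vec.subspace_def dot_simps)
    ultimately have "vec.span B \<subseteq> {y. y \<odot> z = 0}" by (rule vec.span_minimal)
    then have "z \<odot> y = 0" for y using \<open>UNIV \<subseteq> vec.span B\<close> by (subst dot_commute) blast
    then have "z = 0" by (rule dot_eq_0_imp_0)
    then have "z $ 1 = 0" "z $ 2 = 0" "z $ 3 = 0" "z $ 4 = 0" by simp_all
    then show False using uv(3) by (simp add: z_def u v)
  qed
  then obtain z where z: "z \<noteq> 0" "\<And>y. y \<in> q ` \<sigma> \<Longrightarrow> y \<odot> z = 0"
    by (rule dim_less_imp_annihilator) blast
  let ?u = "z $ 1 *s w1 + z $ 2 *s w2" and ?v = "z $ 3 *s w1 + z $ 4 *s w2"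
  have "?u \<in> vec.span {w1, w2}" "?v \<in> vec.span {w1, w2}" unfolding span_pair by blast+
  moreover have "?u \<noteq> 0 \<or> ?v \<noteq> 0"
    using indep2D[OF w, of "z $ 1" "z $ 2"] indep2D[OF w, of "z $ 3" "z $ 4"] z(1)
    by (auto simp: vec_eq_iff[of z] forall_4)
  moreover have "h i \<odot> (X i *s ?u + Y i *s ?v) = 0" if "i \<in> \<sigma>" for i
    unfolding q using z(2) that by blast
  ultimately show ?thesis by blast
qed

section \<open>The line multiview variety\<close>

text \<open>What the choice of \<open>f\<close> provides: the points lie on a line that is skew to the given line through
  the centers, and pairwise independence turns the third point into a combination of the first two
  with nonzero coefficients.\<close>

lemma valid_choiceD:
  assumes valid: "valid_choice C E' f" and \<sigma>: "\<sigma> \<in> four_collinear C"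
    and cam: "\<And>i. camera (C i) (c i)"
    and indep: "\<And>i j. i \<noteq> j \<Longrightarrow> indep2 (c i) (c j)"
    and E: "indep2 e1 e2" "\<And>i. i \<in> \<sigma> \<Longrightarrow> c i \<in> vec.span {e1, e2}"
  shows "indep2 (f \<sigma> 1) (f \<sigma> 2)"
    "vec.span {e1, e2} \<inter> vec.span {f \<sigma> 1, f \<sigma> 2} = {0}"
    "\<exists>s t. f \<sigma> 3 = s *s f \<sigma> 1 + t *s f \<sigma> 2 \<and> s \<noteq> 0 \<and> t \<noteq> 0"
proof -
  have line: "is_line (E' \<sigma>)" and disj: "E' \<sigma> \<inter> centers_line C \<sigma> = {0}"
    and f: "\<And>k. f \<sigma> k \<noteq> 0 \<and> f \<sigma> k \<in> E' \<sigma>" and inj: "inj (\<lambda>k. proj_point (f \<sigma> k))"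
    using valid \<sigma> by (auto simp: valid_choice_def)
  have neq: "(1 :: 3) \<noteq> 2" "(1 :: 3) \<noteq> 3" "(2 :: 3) \<noteq> 3" by simp_all
  have ind: "indep2 (f \<sigma> k) (f \<sigma> l)" if "k \<noteq> l" for k l
    using that injD[OF inj, of k l] f by (intro indep2_if_proj_point_neq) auto
  show f12: "indep2 (f \<sigma> 1) (f \<sigma> 2)" by (intro ind neq)
  have E': "E' \<sigma> = vec.span {f \<sigma> 1, f \<sigma> 2}"
    using is_line_eq_span_pair[OF line _ _ f12] f by blast
  have "card \<sigma> = 4" using \<sigma> by (simp add: four_collinear_def)
  then obtain i where i: "i \<in> \<sigma>" by fastforce
  have "\<sigma> \<noteq> {i}" using \<open>card \<sigma> = 4\<close> by auto
  then obtain j where j: "j \<in> \<sigma>" "i \<noteq> j" using i by blast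
  have "vec.span {e1, e2} = vec.span {c i, c j}"
    using is_line_eq_span_pair[of "vec.span {e1, e2}" "c i" "c j"] E i j indep is_line_span_pair by blast
  also have "\<dots> \<subseteq> centers_line C \<sigma>"
    unfolding centers_line_def
    using i j camera.center_mult[OF cam] by (intro vec.span_mono) (auto simp: center_def)
  finally show "vec.span {e1, e2} \<inter> vec.span {f \<sigma> 1, f \<sigma> 2} = {0}"
    using disj vec.span_zero unfolding E' by blast
  have "f \<sigma> 3 \<in> vec.span {f \<sigma> 1, f \<sigma> 2}" using f E' by blast
  then obtain s t where st: "f \<sigma> 3 = s *s f \<sigma> 1 + t *s f \<sigma> 2" by (auto simp: span_pair)
  have "s \<noteq> 0"
  proof
    assume "s = 0"
    then have "t *s f \<sigma> 2 + - 1 *s f \<sigma> 3 = 0" using st by simp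
    from indep2D[OF ind[OF neq(3)] this] show False by simp
  qed
  moreover have "t \<noteq> 0"
  proof
    assume "t = 0"
    then have "s *s f \<sigma> 1 + - 1 *s f \<sigma> 3 = 0" using st by simp
    from indep2D[OF ind[OF neq(2)] this] show False by simp
  qed
  ultimately show "\<exists>s t. f \<sigma> 3 = s *s f \<sigma> 1 + t *s f \<sigma> 2 \<and> s \<noteq> 0 \<and> t \<noteq> 0"
    using st by blast
qed

lemma det_Phi_vanishes_on_lines:
  fixes C :: "'m::{finite,linorder} \<Rightarrow> complex ^ 4 ^ 3"
  assumes valid: "valid_choice C E' f" and \<sigma>: "\<sigma> \<in> four_collinear C"
    and cam: "\<And>i. camera (C i) (c i)"
    and indep: "\<And>i j. i \<noteq> j \<Longrightarrow> indep2 (c i) (c j)"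
    and ab: "indep2 a b" "\<And>i. (x i v* C i) \<odot> a = 0" "\<And>i. (x i v* C i) \<odot> b = 0"
    and avoid: "\<And>i. c i \<notin> vec.span {a, b}"
  shows "poly_eval x (det (Phi C c (f \<sigma>) \<sigma>)) = 0"
proof -
  have card: "card \<sigma> = 4" using \<sigma> by (simp add: four_collinear_def)
  obtain E where "is_line E" and cE: "\<And>i. i \<in> \<sigma> \<Longrightarrow> c i \<in> E"
    using \<sigma> camera.center_subset_iff[OF cam]
    by (auto simp: four_collinear_def collinear_cameras_def is_line_def)
  then obtain e1 e2 where E: "indep2 e1 e2" "E = vec.span {e1, e2}" using is_line_basis by blast
  have "\<exists>X Y. c i = X *s e1 + Y *s e2" if "i \<in> \<sigma>" for i
    using cE[OF that] by (auto simp: E span_pair)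
  then obtain X Y where XY: "\<And>i. i \<in> \<sigma> \<Longrightarrow> c i = X i *s e1 + Y i *s e2" by metis
  have f: "indep2 (f \<sigma> 1) (f \<sigma> 2)" "vec.span {e1, e2} \<inter> vec.span {f \<sigma> 1, f \<sigma> 2} = {0}"
    "\<exists>s t. f \<sigma> 3 = s *s f \<sigma> 1 + t *s f \<sigma> 2 \<and> s \<noteq> 0 \<and> t \<noteq> 0"
    by (rule valid_choiceD[OF valid \<sigma> cam indep E(1)]; use cE E(2) in blast)+
  obtain s t where st: "f \<sigma> 3 = s *s f \<sigma> 1 + t *s f \<sigma> 2" "s \<noteq> 0" "t \<noteq> 0" using f(3) by blast
  obtain i where "i \<in> \<sigma>" using card by fastforce
  then have "vec.span {e1, e2} \<noteq> vec.span {a, b}" using cE avoid E(2) by blast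
  moreover have "(x i v* C i) \<odot> a = 0 \<and> (x i v* C i) \<odot> b = 0 \<and> (x i v* C i) \<odot> (X i *s e1 + Y i *s e2) = 0"
    if "i \<in> \<sigma>" for i
  proof -
    have "(x i v* C i) \<odot> c i = 0"
      by (simp add: dot_vector_matrix camera.center_mult[OF cam] dot_simps)
    then show ?thesis using ab XY[OF that] by simp
  qed
  ultimately have "\<exists>u v. u \<in> vec.span {f \<sigma> 1, f \<sigma> 2} \<and> v \<in> vec.span {f \<sigma> 1, f \<sigma> 2} \<and>
      (u \<noteq> 0 \<or> v \<noteq> 0) \<and> (\<forall>i\<in>\<sigma>. (x i v* C i) \<odot> (X i *s u + Y i *s v) = 0)"
    by (rule dual_map_of_transversal[OF E(1) f(1,2) ab(1)])
  then show ?thesis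
    by (rule det_Phi_vanishes_iff[OF card E(1) f(1,2) st, THEN iffD2, rotated 2]) (erule XY, rule indep)
qed

text \<open>The reference lines of the determinants differ from one set of four cameras to the next.  To
  compare the resulting maps, their values are projected along the common line \<open>L\<close> to one fixed
  complement; this does not affect the conditions, since all planes contain \<open>L\<close>.\<close>

lemma point_on_variety_if_det_Phi_vanish:
  fixes C :: "'m::{finite,linorder} \<Rightarrow> complex ^ 4 ^ 3"
  assumes valid: "valid_choice C E' f"
    and cam: "\<And>i. camera (C i) (c i)"
    and indep: "\<And>i j. i \<noteq> j \<Longrightarrow> indep2 (c i) (c j)"
    and x: "\<And>i. x i \<noteq> 0"
    and ab: "indep2 a b" "\<And>i. (x i v* C i) \<odot> a = 0" "\<And>i. (x i v* C i) \<odot> b = 0"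
    and Phi: "\<And>\<sigma>. \<sigma> \<in> four_collinear C \<Longrightarrow> poly_eval x (det (Phi C c (f \<sigma>) \<sigma>)) = 0"
  shows "(\<lambda>i. proj_point (x i)) \<in> line_multiview_variety C"
proof -
  define h where "h i = x i v* C i" for i
  have ha: "h i \<odot> a = 0" and hb: "h i \<odot> b = 0" for i using ab by (simp_all add: h_def)
  have h0: "h i \<noteq> 0" for i using camera.rows_independent[OF cam] x h_def by metis
  define \<sigma> where "\<sigma> = {i. c i \<in> vec.span {a, b}}"
  have "\<exists>X Y. c i = X *s a + Y *s b" if "i \<in> \<sigma>" for i
    using that by (auto simp: \<sigma>_def span_pair)
  then obtain X Y where XY: "\<And>i. i \<in> \<sigma> \<Longrightarrow> c i = X i *s a + Y i *s b" by metis
  obtain w1 w2 where w: "indep2 w1 w2" "vec.span {a, b} \<inter> vec.span {w1, w2} = {0}"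
    using complement_exists[OF ab(1)] by blast
  have proj: "\<exists>y'. y' \<in> vec.span {w1, w2} \<and> (\<exists>\<alpha> \<beta>. y = \<alpha> *s a + \<beta> *s b + y')" for y
    using frame_decomposition[OF ab(1) w, of y] by blast
  have four: "\<exists>u v. u \<in> vec.span {w1, w2} \<and> v \<in> vec.span {w1, w2} \<and> (u \<noteq> 0 \<or> v \<noteq> 0) \<and>
        (\<forall>i\<in>\<tau>. h i \<odot> (X i *s u + Y i *s v) = 0)" if \<tau>: "\<tau> \<subseteq> \<sigma>" "card \<tau> = 4" for \<tau>
  proof -
    have sub: "c i \<in> vec.span {a, b}" if "i \<in> \<tau>" for i using that \<tau> by (auto simp: \<sigma>_def)
    then have four: "\<tau> \<in> four_collinear C"
      unfolding four_collinear_def collinear_cameras_def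
      using \<tau>(2) ab(1) is_line_span_pair[of a b] camera.center_subset_iff[OF cam]
      by (auto simp: is_line_def intro!: exI[of _ "vec.span {a, b}"])
  have f: "indep2 (f \<tau> 1) (f \<tau> 2)" "vec.span {a, b} \<inter> vec.span {f \<tau> 1, f \<tau> 2} = {0}"
    "\<exists>s t. f \<tau> 3 = s *s f \<tau> 1 + t *s f \<tau> 2 \<and> s \<noteq> 0 \<and> t \<noteq> 0"
    by (rule valid_choiceD[OF valid four cam indep ab(1)]; use sub in blast)+
    obtain s t where st: "f \<tau> 3 = s *s f \<tau> 1 + t *s f \<tau> 2" "s \<noteq> 0" "t \<noteq> 0" using f(3) by blast
    have XY': "c i = X i *s a + Y i *s b" if "i \<in> \<tau>" for i using XY that \<tau> by blast
    obtain u' v' where uv': "u' \<in> vec.span {f \<tau> 1, f \<tau> 2}" "v' \<in> vec.span {f \<tau> 1, f \<tau> 2}"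
      "u' \<noteq> 0 \<or> v' \<noteq> 0" "\<And>i. i \<in> \<tau> \<Longrightarrow> h i \<odot> (X i *s u' + Y i *s v') = 0"
    proof -
      have "\<exists>u v. u \<in> vec.span {f \<tau> 1, f \<tau> 2} \<and> v \<in> vec.span {f \<tau> 1, f \<tau> 2} \<and>
          (u \<noteq> 0 \<or> v \<noteq> 0) \<and> (\<forall>i\<in>\<tau>. (x i v* C i) \<odot> (X i *s u + Y i *s v) = 0)"
        by (rule det_Phi_vanishes_iff[OF \<tau>(2) ab(1) f(1,2) st, THEN iffD1, OF _ _ Phi[OF four]])
          (erule XY', rule indep)
      then show ?thesis using that unfolding h_def by blast
    qed
    obtain u \<alpha> \<beta> where u: "u \<in> vec.span {w1, w2}" "u' = \<alpha> *s a + \<beta> *s b + u" using proj by blast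
    obtain v \<gamma> \<delta> where v: "v \<in> vec.span {w1, w2}" "v' = \<gamma> *s a + \<delta> *s b + v" using proj by blast
    have "u \<noteq> 0 \<or> v \<noteq> 0"
    proof (rule ccontr)
      assume "\<not> (u \<noteq> 0 \<or> v \<noteq> 0)"
      then have "u' \<in> vec.span {a, b}" "v' \<in> vec.span {a, b}"
        using u(2) v(2) by (auto simp: span_pair)
      then show False using uv'(1,2,3) f(2) by blast
    qed
    moreover have "h i \<odot> (X i *s u + Y i *s v) = 0" if "i \<in> \<tau>" for i
      using uv'(4)[OF that] by (simp add: u(2) v(2) dot_simps ha hb)
    ultimately show ?thesis using u(1) v(1) by blast
  qed
  obtain u v where uv: "u \<in> vec.span {w1, w2}" "v \<in> vec.span {w1, w2}" "u \<noteq> 0 \<or> v \<noteq> 0"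
    "\<And>i. i \<in> \<sigma> \<Longrightarrow> h i \<odot> (X i *s u + Y i *s v) = 0"
    using common_solution_if_four_by_four[OF w(1) four] by blast
  have out: "\<exists>w. w \<notin> vec.span {a, b} \<and> h i \<odot> w = 0" for i
  proof -
    define y where "y = (h i \<odot> w2) *s w1 + (- (h i \<odot> w1)) *s w2"
    have "y \<noteq> 0"
    proof
      assume "y = 0"
      then have "h i \<odot> w2 = 0 \<and> - (h i \<odot> w1) = 0"
        unfolding y_def by (rule indep2D[OF w(1)])
      then have z: "h i \<odot> w2 = 0" "h i \<odot> w1 = 0" by simp_all
      have "h i \<odot> y = 0" for y
      proof -
        obtain y' \<alpha> \<beta> where "y' \<in> vec.span {w1, w2}" "y = \<alpha> *s a + \<beta> *s b + y'"
          using proj by blast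
        then show ?thesis by (auto simp: span_pair dot_simps ha hb z)
      qed
      then show False using dot_eq_0_imp_0 h0 by blast
    qed
    moreover have "y \<in> vec.span {w1, w2}" unfolding y_def span_pair by blast
    moreover have "h i \<odot> y = 0" by (simp add: y_def dot_simps algebra_simps)
    ultimately show ?thesis using w(2) by blast
  qed
  have XYneq: "X i * Y j - X j * Y i \<noteq> 0" if "i \<in> \<sigma>" "j \<in> \<sigma>" "i \<noteq> j" for i j
    using coefficient_det_neq_0[OF indep[OF that(3)] XY[OF that(1)] XY[OF that(2)]] .
  have XY0: "X i \<noteq> 0 \<or> Y i \<noteq> 0" if "i \<in> \<sigma>" for i
    using XY[OF that] camera.center_neq_0[OF cam, of i] by auto
  obtain u' v' where uv': "\<And>i. i \<in> \<sigma> \<Longrightarrow> X i *s u + Y i *s v = 0 \<Longrightarrow>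
     X i *s u' + Y i *s v' \<notin> vec.span {a, b} \<and> h i \<odot> (X i *s u' + Y i *s v') = 0"
    using second_order_term[of u v \<sigma> X Y "vec.span {a, b}" h, OF uv(3) XYneq XY0 out] by blast
  have skew: "X i *s u + Y i *s v \<notin> vec.span {a, b}" if "X i *s u + Y i *s v \<noteq> 0" for i
  proof -
    have "X i *s u + Y i *s v \<in> vec.span {w1, w2}"
      using uv(1,2) by (intro vec.span_add vec.span_scale)
    then show ?thesis using that w(2) by blast
  qed
  let ?a = "\<lambda>t. a + t *s u + t\<^sup>2 *s u'" and ?b = "\<lambda>t. b + t *s v + t\<^sup>2 *s v'"
  have "\<exists>\<mu> k z. \<mu> \<noteq> 0 \<and> (\<forall>t. cross_prod (C i *v ?a t) (C i *v ?b t) = (\<mu> * t ^ k) *s z t) \<and>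
    (z \<longlongrightarrow> x i) (at 0)" for i
  proof (rule image_of_moving_line[OF cam ab(1) ab(2,3) x, of i "X i" "Y i"])
    assume "c i \<in> vec.span {a, b}"
    then have i: "i \<in> \<sigma>" by (simp add: \<sigma>_def)
    show "c i = X i *s a + Y i *s b" by (rule XY[OF i])
    show "(x i v* C i) \<odot> (X i *s u + Y i *s v) = 0" using uv(4)[OF i] by (simp only: h_def)
    show "X i *s u + Y i *s v \<notin> vec.span {a, b}" if "X i *s u + Y i *s v \<noteq> 0"
      by (rule skew[OF that])
    show "X i *s u' + Y i *s v' \<notin> vec.span {a, b} \<and> (x i v* C i) \<odot> (X i *s u' + Y i *s v') = 0"
      if "X i *s u + Y i *s v = 0"
      using uv'[OF i that] unfolding h_def .
  qed
  then obtain \<mu> k z where z: "\<And>i. \<mu> i \<noteq> 0"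
    "\<And>i t. cross_prod (C i *v ?a t) (C i *v ?b t) = (\<mu> i * t ^ k i) *s z i t"
    "\<And>i. (z i \<longlongrightarrow> x i) (at 0)"
    by metis
  show ?thesis
    by (rule limit_in_line_multiview_variety[OF cam x z(2,1,3)])
qed

theorem corollary5p6:
  fixes C :: "'m::{finite,linorder} \<Rightarrow> complex ^ 4 ^ 3"
    and c :: "'m \<Rightarrow> complex ^ 4"
    and E' :: "'m set \<Rightarrow> (complex ^ 4) set"
    and f :: "'m set \<Rightarrow> 3 \<Rightarrow> complex ^ 4"
  assumes "camera_arrangement C"
    and "\<And>i. proj_point (c i) = center (C i)"
    and "valid_choice C E' f"
  shows "line_multiview_variety C = zero_locus (tilde_ideal C c f)"
proof -
  have cam: "camera (C i) (c i)" for i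
    using assms(1,2) by (simp add: camera_def camera_arrangement_def)
  have indep: "indep2 (c i) (c j)" if "i \<noteq> j" for i j
  proof (rule indep2_if_proj_point_neq)
    show "proj_point (c i) \<noteq> proj_point (c j)"
      using assms(1,2) that by (auto simp: camera_arrangement_def dest: injD)
  qed (rule camera.center_neq_0[OF cam])+
  show ?thesis
  proof (rule antisym)
    have "(\<lambda>i. proj_point (cross_prod (C i *v a) (C i *v b))) \<in> zero_locus (tilde_ideal C c f)"
      if line: "is_line (vec.span {a, b})" and avoid: "\<And>i. \<not> center (C i) \<subseteq> vec.span {a, b}" for a b
    proof -
      have ab: "indep2 a b" using line by (simp add: is_line_span_pair)
      have avoid': "c i \<notin> vec.span {a, b}" for i
        using avoid camera.center_subset_iff[OF cam] line by (auto simp: is_line_def)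
      then have "indep2 (C i *v a) (C i *v b)" for i
        by (intro camera.image_indep2[OF cam ab]) (auto simp: span_pair)
      then have nz: "cross_prod (C i *v a) (C i *v b) \<noteq> 0" for i
        by (simp add: cross_prod_eq_0_iff)
      have "\<forall>p\<in>tilde_ideal C c f. poly_eval x p = 0"
        if x: "\<forall>i. proj_point (x i) = proj_point (cross_prod (C i *v a) (C i *v b))" for x
      proof -
        have "(x i v* C i) \<odot> a = 0" "(x i v* C i) \<odot> b = 0" for i
        proof -
          obtain t where "x i = t *s cross_prod (C i *v a) (C i *v b)"
            using proj_point_eq_imp_multiple[OF spec[OF x] nz] by blast
          then show "(x i v* C i) \<odot> a = 0" "(x i v* C i) \<odot> b = 0"
            by (simp_all add: dot_vector_matrix dot_simps cross_prod_dot)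
        qed
        note h = this
        have "\<forall>p\<in>minors3 (back_matrix C). poly_eval x p = 0"
          unfolding minors3_vanish_iff
          by (intro allI impI minors_vanish_if_common_line[OF ab h]) (auto dest: strict_mono_imp_inj_on)
        then show ?thesis
          unfolding poly_eval_tilde_ideal_iff
          using det_Phi_vanishes_on_lines[OF assms(3) _ cam indep ab h avoid'] by blast
      qed
      then show ?thesis
        using nz by (auto simp: zero_locus_eq multiproj_def proj_space_def)
    qed
    then show "line_multiview_variety C \<subseteq> zero_locus (tilde_ideal C c f)"
      unfolding line_multiview_variety_def zariski_closure_def
      by (intro Inter_lower) (auto simp: zariski_closed_zero_locus)
  next
    show "zero_locus (tilde_ideal C c f) \<subseteq> line_multiview_variety C"
    proof
      fix P assume P: "P \<in> zero_locus (tilde_ideal C c f)"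
      then have "\<forall>i. \<exists>v. v \<noteq> 0 \<and> P i = proj_point v"
        by (simp add: zero_locus_def multiproj_def proj_space_def) metis
      then obtain x where x: "\<And>i. x i \<noteq> 0" "\<And>i. P i = proj_point (x i)" by metis
      then have vanish: "\<forall>p\<in>tilde_ideal C c f. poly_eval x p = 0"
        using P by (simp add: zero_locus_eq)
      then have "vec.dim (range (\<lambda>i. x i v* C i)) \<le> 2"
        unfolding poly_eval_tilde_ideal_iff minors3_vanish_iff
        by (intro dim_le_2_if_minors_vanish) blast
      then obtain a b where ab: "indep2 a b" "\<And>h. h \<in> range (\<lambda>i. x i v* C i) \<Longrightarrow> h \<odot> a = 0"
        "\<And>h. h \<in> range (\<lambda>i. x i v* C i) \<Longrightarrow> h \<odot> b = 0"
        by (rule common_line_if_dim_le_2) blast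
      have "(\<lambda>i. proj_point (x i)) \<in> line_multiview_variety C"
      proof (rule point_on_variety_if_det_Phi_vanish[OF assms(3) cam indep x(1) ab(1)])
        show "poly_eval x (det (Phi C c (f \<sigma>) \<sigma>)) = 0" if "\<sigma> \<in> four_collinear C" for \<sigma>
          using vanish that unfolding poly_eval_tilde_ideal_iff by blast
      qed (use ab in auto)
      moreover have "P = (\<lambda>i. proj_point (x i))" using x(2) by auto
      ultimately show "P \<in> line_multiview_variety C" by simp
    qed
  qed
qed

end
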